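(* Given an affine $\mathbb Z$-VASS $\mathcal V=(d,Q,T)$ with the finite-monoid property and $p,q\in Q$, it is possible to compute an existential Presburger formula $\varphi_{\mathcal V,p,q}(\mathbf x,\mathbf y)$ (with $\mathbf x,\mathbf y$ tuples of $d$ free variables) of size at most $\mathcal O(\mathrm{poly}(|\mathcal V|,|\mathcal M_{\mathcal V}|,\log\|\mathcal M_{\mathcal V}\|))$ such that for all $\mathbf u,\mathbf v\in\mathbb Z^d$, $\varphi_{\mathcal V,p,q}(\mathbf u,\mathbf v)$ holds if and only if $p(\mathbf u)\xrightarrow{*}q(\mathbf v)$ in $\mathcal V$.
   Context: An affine $\mathbb Z$-VASS is a triple $\mathcal V=(d,Q,T)$ with $d\in\mathbb N$, $Q$ a finite set of control-states and $T\subseteq Q\times\mathbb Z^{d\times d}\times\mathbb Z^d\times Q$ a finite set of transitions. A configuration is a pair written $q(\mathbf v)$ with $q\in Q$, $\mathbf v\in\mathbb Z^d$; $p(\mathbf u)\xrightarrow{t}q(\mathbf v)$ holds iff $t=(p,A,\mathbf b,q)\in T$ and $\mathbf v=A\mathbf u+\mathbf b$; $\xrightarrow{*}$ is the reflexive-transitive closure of the union of the relations $\xrightarrow{t}$, $t\in T$. The monoid $\mathcal M_{\mathcal V}$ is the monoid under matrix multiplication generated by the matrices occurring in transitions of $T$ (it contains the identity); $\mathcal V$ has the finite-monoid property if $\mathcal M_{\mathcal V}$ is finite. Norms: for a vector, the max of absolute values of entries; for a matrix $A$, $\|A\|$ is the maximal max-norm of its columns; for a finite set of matrices, the maximum of norms;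 $\|T\|$ is the maximum of the norms of all vectors and matrices occurring in transitions of $T$. The size of $\mathcal V$ is $|\mathcal V|=d+|Q|+(d^2+d)\cdot|T|\cdot\max(1,\lceil\log(\|T\|+1)\rceil)$. Presburger arithmetic is the first-order theory of $(\mathbb Z,+,<)$; an existential Presburger formula is one of the form $\exists\mathbf z\,\psi$ with $\psi$ quantifier-free. *)

theory Defs
  imports
    Complex_Main
    "HOL-Library.Nat_Bijection"
    "HOL-Library.Log_Nat"
    "Jordan_Normal_Form.Matrix"
begin

section \<open>Affine integer VASS\<close>

record 'q avass =
  dimension :: nat
  states :: "'q set"
  transitions :: "('q \<times> int mat \<times> int vec \<times> 'q) set"

definition affine_zvass :: "'q avass \<Rightarrow> bool" where
  "affine_zvass V \<longleftrightarrow> finite (states V) \<and> finite (transitions V) \<and>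
     transitions V \<subseteq> states V \<times> carrier_mat (dimension V) (dimension V)
                    \<times> carrier_vec (dimension V) \<times> states V"

definition step ::
    "'q avass \<Rightarrow> 'q \<times> int mat \<times> int vec \<times> 'q \<Rightarrow> 'q \<times> int vec \<Rightarrow> 'q \<times> int vec \<Rightarrow> bool" where
  "step V t c c' \<longleftrightarrow> t \<in> transitions V \<and>
     (\<exists>p u q v A b. c = (p, u) \<and> c' = (q, v) \<and> u \<in> carrier_vec (dimension V) \<and>
        t = (p, A, b, q) \<and> v = A *\<^sub>v u + b)"

definition reach :: "'q avass \<Rightarrow> 'q \<times> int vec \<Rightarrow> 'q \<times> int vec \<Rightarrow> bool" where
  "reach V = (\<lambda>c c'. \<exists>t \<in> transitions V. step V t c c')\<^sup>*\<^sup>*"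

definition trans_mats :: "'q avass \<Rightarrow> int mat set" where
  "trans_mats V = {A. \<exists>p b q. (p, A, b, q) \<in> transitions V}"

definition trans_vecs :: "'q avass \<Rightarrow> int vec set" where
  "trans_vecs V = {b. \<exists>p A q. (p, A, b, q) \<in> transitions V}"

inductive_set avass_monoid :: "'q avass \<Rightarrow> int mat set" for V :: "'q avass" where
  one: "1\<^sub>m (dimension V) \<in> avass_monoid V"
| gen: "A \<in> trans_mats V \<Longrightarrow> A \<in> avass_monoid V"
| mult: "A \<in> avass_monoid V \<Longrightarrow> B \<in> avass_monoid V \<Longrightarrow> A * B \<in> avass_monoid V"

definition finite_monoid_property :: "'q avass \<Rightarrow> bool" where
  "finite_monoid_property V \<longleftrightarrow> finite (avass_monoid V)"

text \<open>
  In the maxima below, 0 is inserted so that they are also meaningful in dimension 0 and for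
  empty sets; it does not change the maximum in any other case. In dimension 0 the norm of the
  monoid is 0, and its logarithm is <open>log 2 0 = 0<close>.
\<close>

definition vec_norm :: "int vec \<Rightarrow> int" where
  "vec_norm v = Max (insert 0 {\<bar>v $ i\<bar> | i. i < dim_vec v})"

definition mat_norm :: "int mat \<Rightarrow> int" where
  "mat_norm A = Max (insert 0 {vec_norm (col A j) | j. j < dim_col A})"

definition mats_norm :: "int mat set \<Rightarrow> int" where
  "mats_norm S = Max (insert 0 (mat_norm ` S))"

definition trans_norm :: "'q avass \<Rightarrow> int" where
  "trans_norm V = Max (insert 0 (mat_norm ` trans_mats V \<union> vec_norm ` trans_vecs V))"

definition avass_size :: "'q avass \<Rightarrow> nat" where
  "avass_size V = dimension V + card (states V) +
     ((dimension V)\<^sup>2 + dimension V) * card (transitions V) *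
       max 1 (nat \<lceil>log 2 (real_of_int (trans_norm V) + 1)\<rceil>)"

section \<open>Presburger arithmetic\<close>

text \<open>
  First-order formulas over the integers with addition and order. The constants 0 and 1 belong
  to the language: they are first-order definable from addition and order, but 1 is not
  existentially definable, since scaling by a positive integer is an embedding of the structure
  into itself. There are no other constants and no multiplication by constants, so the size of a
  formula involves no choice of number representation.
\<close>

datatype pterm = PVar nat | PZero | POne | PAdd pterm pterm

datatype pform =
    PLess pterm pterm
  | PEq pterm pterm
  | PNot pform
  | PAnd pform pform
  | POr pform pform
  | PEx nat pform
  | PAll nat pform

primrec teval :: "(nat \<Rightarrow> int) \<Rightarrow> pterm \<Rightarrow> int" where
  "teval e (PVar i) = e i"
| "teval e PZero = 0"
| "teval e POne = 1"
| "teval e (PAdd s t) = teval e s + teval e t"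

primrec holds :: "(nat \<Rightarrow> int) \<Rightarrow> pform \<Rightarrow> bool" where
  "holds e (PLess s t) \<longleftrightarrow> teval e s < teval e t"
| "holds e (PEq s t) \<longleftrightarrow> teval e s = teval e t"
| "holds e (PNot f) \<longleftrightarrow> \<not> holds e f"
| "holds e (PAnd f g) \<longleftrightarrow> holds e f \<and> holds e g"
| "holds e (POr f g) \<longleftrightarrow> holds e f \<or> holds e g"
| "holds e (PEx i f) \<longleftrightarrow> (\<exists>a. holds (e(i := a)) f)"
| "holds e (PAll i f) \<longleftrightarrow> (\<forall>a. holds (e(i := a)) f)"

primrec tvars :: "pterm \<Rightarrow> nat set" where
  "tvars (PVar i) = {i}"
| "tvars PZero = {}"
| "tvars POne = {}"
| "tvars (PAdd s t) = tvars s \<union> tvars t"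

primrec free_vars :: "pform \<Rightarrow> nat set" where
  "free_vars (PLess s t) = tvars s \<union> tvars t"
| "free_vars (PEq s t) = tvars s \<union> tvars t"
| "free_vars (PNot f) = free_vars f"
| "free_vars (PAnd f g) = free_vars f \<union> free_vars g"
| "free_vars (POr f g) = free_vars f \<union> free_vars g"
| "free_vars (PEx i f) = free_vars f - {i}"
| "free_vars (PAll i f) = free_vars f - {i}"

primrec quantifier_free :: "pform \<Rightarrow> bool" where
  "quantifier_free (PLess s t) \<longleftrightarrow> True"
| "quantifier_free (PEq s t) \<longleftrightarrow> True"
| "quantifier_free (PNot f) \<longleftrightarrow> quantifier_free f"
| "quantifier_free (PAnd f g) \<longleftrightarrow> quantifier_free f \<and> quantifier_free g"
| "quantifier_free (POr f g) \<longleftrightarrow> quantifier_free f \<and> quantifier_free g"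
| "quantifier_free (PEx i f) \<longleftrightarrow> False"
| "quantifier_free (PAll i f) \<longleftrightarrow> False"

definition existential :: "pform \<Rightarrow> bool" where
  "existential f \<longleftrightarrow> (\<exists>zs g. quantifier_free g \<and> f = foldr PEx zs g)"

text \<open>
  Size is the number of symbols, where writing the variable with index \<open>i\<close> costs one symbol plus
  the binary digits of \<open>i\<close>.
\<close>

primrec tsize :: "pterm \<Rightarrow> nat" where
  "tsize (PVar i) = 1 + floorlog 2 i"
| "tsize PZero = 1"
| "tsize POne = 1"
| "tsize (PAdd s t) = 1 + tsize s + tsize t"

primrec fsize :: "pform \<Rightarrow> nat" where
  "fsize (PLess s t) = 1 + tsize s + tsize t"
| "fsize (PEq s t) = 1 + tsize s + tsize t"
| "fsize (PNot f) = 1 + fsize f"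
| "fsize (PAnd f g) = 1 + fsize f + fsize g"
| "fsize (POr f g) = 1 + fsize f + fsize g"
| "fsize (PEx i f) = 1 + tsize (PVar i) + fsize f"
| "fsize (PAll i f) = 1 + tsize (PVar i) + fsize f"

text \<open>
  The free variables \<open>x\<^sub>1, \<dots>, x\<^sub>d, y\<^sub>1, \<dots>, y\<^sub>d\<close> are those with indices \<open>0, \<dots>, 2d - 1\<close>, in
  this order. The value of the assignment at larger indices is irrelevant for formulas
  with free variables among these.
\<close>

definition assignment :: "nat \<Rightarrow> int vec \<Rightarrow> int vec \<Rightarrow> nat \<Rightarrow> int" where
  "assignment d u v i = (if i < d then u $ i else if i < 2 * d then v $ (i - d) else 0)"

section \<open>Computability\<close>

text \<open>
  The unary partial recursive functions on the natural numbers, with tuples represented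
  through the pairing bijection \<open>prod_encode\<close>; \<open>None\<close> means that the computation diverges.
\<close>

inductive partial_recursive :: "(nat \<Rightarrow> nat option) \<Rightarrow> bool" where
  zero: "partial_recursive (\<lambda>_. Some 0)"
| succ: "partial_recursive (\<lambda>n. Some (Suc n))"
| left: "partial_recursive (\<lambda>n. Some (fst (prod_decode n)))"
| right: "partial_recursive (\<lambda>n. Some (snd (prod_decode n)))"
| pair: "partial_recursive f \<Longrightarrow> partial_recursive g \<Longrightarrow>
    partial_recursive
      (\<lambda>n. Option.bind (f n) (\<lambda>a. Option.bind (g n) (\<lambda>b. Some (prod_encode (a, b)))))"
| comp: "partial_recursive f \<Longrightarrow> partial_recursive g \<Longrightarrow>
    partial_recursive (\<lambda>n. Option.bind (g n) f)"
| prim_rec: "partial_recursive f \<Longrightarrow> partial_recursive g \<Longrightarrow>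
    partial_recursive
      (\<lambda>x. case prod_decode x of (a, n) \<Rightarrow>
         rec_nat (f a) (\<lambda>m r. Option.bind r (\<lambda>b. g (prod_encode (a, prod_encode (m, b))))) n)"
| minimise: "partial_recursive f \<Longrightarrow>
    partial_recursive
      (\<lambda>a. if \<exists>n. f (prod_encode (a, n)) = Some 0 \<and> (\<forall>m<n. f (prod_encode (a, m)) \<noteq> None)
           then Some (LEAST n. f (prod_encode (a, n)) = Some 0) else None)"

text \<open>
  An instance is given by its dimension, a listing of its states, a listing of its transitions,
  and the two states \<open>p\<close> and \<open>q\<close>; states are written using natural numbers as names. Matrices
  are written as lists of rows.
\<close>

definition vec_code :: "int vec \<Rightarrow> nat" where
  "vec_code v = list_encode (map int_encode (list_of_vec v))"

definition mat_code :: "int mat \<Rightarrow> nat" where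
  "mat_code A = list_encode (map (\<lambda>r. list_encode (map int_encode r)) (mat_to_list A))"

fun trans_code :: "('q \<Rightarrow> nat) \<Rightarrow> 'q \<times> int mat \<times> int vec \<times> 'q \<Rightarrow> nat" where
  "trans_code name (p, A, b, q) = list_encode [name p, mat_code A, vec_code b, name q]"

definition instance_code ::
    "('q \<Rightarrow> nat) \<Rightarrow> nat \<Rightarrow> 'q list \<Rightarrow> ('q \<times> int mat \<times> int vec \<times> 'q) list \<Rightarrow> 'q \<Rightarrow> 'q \<Rightarrow> nat" where
  "instance_code name d qs ts p q =
     list_encode [d, list_encode (map name qs), list_encode (map (trans_code name) ts),
                  name p, name q]"

definition is_instance_code :: "nat \<Rightarrow> 'q avass \<Rightarrow> 'q \<Rightarrow> 'q \<Rightarrow> bool" where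
  "is_instance_code w V p q \<longleftrightarrow>
     (\<exists>name qs ts. inj_on name (states V) \<and>
        distinct qs \<and> set qs = states V \<and> distinct ts \<and> set ts = transitions V \<and>
        w = instance_code name (dimension V) qs ts p q)"

primrec tcode :: "pterm \<Rightarrow> nat" where
  "tcode (PVar i) = prod_encode (0, i)"
| "tcode PZero = prod_encode (1, 0)"
| "tcode POne = prod_encode (2, 0)"
| "tcode (PAdd s t) = prod_encode (3, prod_encode (tcode s, tcode t))"

primrec fcode :: "pform \<Rightarrow> nat" where
  "fcode (PLess s t) = prod_encode (0, prod_encode (tcode s, tcode t))"
| "fcode (PEq s t) = prod_encode (1, prod_encode (tcode s, tcode t))"
| "fcode (PNot f) = prod_encode (2, fcode f)"
| "fcode (PAnd f g) = prod_encode (3, prod_encode (fcode f, fcode g))"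
| "fcode (POr f g) = prod_encode (4, prod_encode (fcode f, fcode g))"
| "fcode (PEx i f) = prod_encode (5, prod_encode (i, fcode f))"
| "fcode (PAll i f) = prod_encode (6, prod_encode (i, fcode f))"

lemma tcode_eq_iff: "tcode s = tcode t \<longleftrightarrow> s = t"
proof (induction s arbitrary: t)
  case (PVar i)
  then show ?case by (cases t) auto
next
  case PZero
  then show ?case by (cases t) auto
next
  case POne
  then show ?case by (cases t) auto
next
  case (PAdd s1 s2)
  then show ?case by (cases t) auto
qed

lemma fcode_eq_iff: "fcode f = fcode g \<longleftrightarrow> f = g"
proof (induction f arbitrary: g)
  case (PLess s t)
  then show ?case by (cases g) (auto simp: tcode_eq_iff)
next
  case (PEq s t)
  then show ?case by (cases g) (auto simp: tcode_eq_iff)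
next
  case (PNot f)
  then show ?case by (cases g) auto
next
  case (PAnd f1 f2)
  then show ?case by (cases g) auto
next
  case (POr f1 f2)
  then show ?case by (cases g) auto
next
  case (PEx i f)
  then show ?case by (cases g) auto
next
  case (PAll i f)
  then show ?case by (cases g) auto
qed

end

(*
  Read backwards, a run from p to q is a walk in the finite graph on pairs (state, N), where N is
  the product of the matrices of the part of the run already seen: putting (p, A, b, r) in front
  moves from (r, N) to (p, N * A) and contributes N b to the effect. Reachability thus becomes
  reachability in an integer VASS without matrices, and a vector of edge multiplicities comes from
  a walk iff it satisfies the flow equations and its support is connected to the source; the latter
  is witnessed by ranks of the edges. Large coefficients are handled by variables for the powers of
  two times each variable. The monoid is generated by iterated multiplication, which stops because
  the monoid is finite; this is the only unbounded search.
*)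

theory Submission imports Defs begin

section \<open>Computable functions between encoded types\<close>

text \<open>The direction of reading is forced: the vector of a transition is multiplied by the
  matrices of all transitions after it, so its contribution is fixed only once their product is.
  Read backwards, that product is part of the current node and every edge has a constant weight. The
  price is a graph with at most |M| |T| edges, through which the size of the monoid M enters the
  formula. The starting vector is multiplied by the product reached at the end of the walk; since a
  Presburger term needs constant coefficients, there is one disjunct for each such product.
  Connectivity expressed by cuts would range over exponentially many sets of nodes, whereas ranks
  cost one integer variable per edge. Neither the number of multiplication rounds nor the bit length
  of the coefficients is part of the input. A single parameter bounding both is searched for, and
  since the least one is taken, any admissible value bounds the size of the formula. The final
  degree 18 is 6 * 3: six from the nesting of sums, conjunctions and disjunctions, three from the
  number of edges, where |T| is at most the square of the size of the VASS.\<close>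

definition recursive :: "(nat \<Rightarrow> nat) \<Rightarrow> bool" where
  "recursive f \<longleftrightarrow> partial_recursive (\<lambda>n. Some (f n))"

lemma recursive_zero: "recursive (\<lambda>_. 0)"
  unfolding recursive_def by (rule partial_recursive.zero)

lemma recursive_Suc: "recursive Suc"
  unfolding recursive_def by (rule partial_recursive.succ)

lemma recursive_fst: "recursive (\<lambda>n. fst (prod_decode n))"
  unfolding recursive_def by (rule partial_recursive.left)

lemma recursive_snd: "recursive (\<lambda>n. snd (prod_decode n))"
  unfolding recursive_def by (rule partial_recursive.right)

lemma recursive_pair:
  "recursive f \<Longrightarrow> recursive g \<Longrightarrow> recursive (\<lambda>n. prod_encode (f n, g n))"
  unfolding recursive_def by (drule (1) partial_recursive.pair) simp

lemma recursive_comp: "recursive f \<Longrightarrow> recursive g \<Longrightarrow> recursive (\<lambda>n. f (g n))"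
  unfolding recursive_def by (drule (1) partial_recursive.comp) simp

lemma recursive_id: "recursive (\<lambda>n. n)"
  using recursive_pair[OF recursive_fst recursive_snd] by simp

lemma recursive_const: "recursive (\<lambda>_. c)"
  by (induction c) (use recursive_zero recursive_comp[OF recursive_Suc] in auto)

lemma recursive_rec_nat:
  assumes "recursive f" "recursive g"
  shows "recursive (\<lambda>x. case prod_decode x of (a, n) \<Rightarrow>
           rec_nat (f a) (\<lambda>m r. g (prod_encode (a, prod_encode (m, r)))) n)"
proof -
  have "rec_nat (Some (f a)) (\<lambda>m r. Option.bind r (\<lambda>b. Some (g (prod_encode (a, prod_encode (m, b)))))) n
      = Some (rec_nat (f a) (\<lambda>m r. g (prod_encode (a, prod_encode (m, r)))) n)" for a n
    by (induction n) auto
  then show ?thesis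
    using partial_recursive.prim_rec[OF assms[unfolded recursive_def]]
    unfolding recursive_def by (simp add: case_prod_beta')
qed

section \<open>Codings of types by natural numbers\<close>

class coded =
  fixes code :: "'a \<Rightarrow> nat"

text \<open>Bijectivity makes \<open>decode\<close> a total two-sided inverse, so on the level of
  codes decoding is the identity and every number may be decoded. Truth values, terms and formulas
  are only ever produced, hence merely \<open>coded\<close>.\<close>

class bicoded = coded +
  assumes bij_code: "bij code"

instantiation nat :: bicoded
begin
definition code_nat :: "nat \<Rightarrow> nat" where "code_nat n = n"
instance by standard (simp add: code_nat_def bij_def inj_on_def surj_def)
end

instantiation bool :: coded
begin
definition code_bool :: "bool \<Rightarrow> nat" where "code_bool b = of_bool b"
instance ..
end

instantiation int :: bicoded
begin
definition code_int :: "int \<Rightarrow> nat" where "code_int = int_encode"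
instance by standard (simp add: code_int_def bij_int_encode)
end

instantiation prod :: (coded, coded) coded
begin
definition code_prod :: "'a \<times> 'b \<Rightarrow> nat" where
  "code_prod z = prod_encode (code (fst z), code (snd z))"
instance ..
end

instance prod :: (bicoded, bicoded) bicoded
proof
  have eq: "code = prod_encode \<circ> map_prod (code :: 'a \<Rightarrow> nat) (code :: 'b \<Rightarrow> nat)"
    by (auto simp: code_prod_def fun_eq_iff)
  have "bij (map_prod (code :: 'a \<Rightarrow> nat) (code :: 'b \<Rightarrow> nat))"
    using bij_betw_map_prod[OF bij_code bij_code] by simp
  then show "bij (code :: 'a \<times> 'b \<Rightarrow> nat)"
    by (subst eq) (rule bij_comp[OF _ bij_prod_encode])
qed

instantiation list :: (coded) coded
begin
definition code_list :: "'a list \<Rightarrow> nat" where "code_list xs = list_encode (map code xs)"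
instance ..
end

instance list :: (bicoded) bicoded
proof
  have eq: "code = list_encode \<circ> map (code :: 'a \<Rightarrow> nat)"
    by (auto simp: code_list_def fun_eq_iff)
  have "bij (map (code :: 'a \<Rightarrow> nat))"
    using bij_code[where ?'a = 'a] lists_image[of "code :: 'a \<Rightarrow> nat" UNIV] by (auto simp: bij_def)
  then show "bij (code :: 'a list \<Rightarrow> nat)"
    by (subst eq) (rule bij_comp[OF _ bij_list_encode])
qed

instantiation pterm :: coded
begin
definition code_pterm :: "pterm \<Rightarrow> nat" where "code_pterm = tcode"
instance ..
end

instantiation pform :: coded
begin
definition code_pform :: "pform \<Rightarrow> nat" where "code_pform = fcode"
instance ..
end

lemma code_eq_iff: "code (x :: 'a :: bicoded) = code y \<longleftrightarrow> x = y"
  using bij_code by (auto simp: bij_def inj_def)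

definition decode :: "nat \<Rightarrow> 'a :: bicoded" where
  "decode = inv_into UNIV code"

lemma code_decode [simp]: "code (decode n :: 'a :: bicoded) = n"
  unfolding decode_def using bij_code by (metis bij_inv_eq_iff)

lemma decode_code [simp]: "decode (code (x :: 'a :: bicoded)) = x"
  using code_decode[of "code x", where ?'a = 'a] by (simp only: code_eq_iff)

text \<open>The function \<open>g\<close> is prescribed on codes only, which admits types whose
  codes do not exhaust the naturals.\<close>

definition computable :: "('a :: coded \<Rightarrow> 'b :: coded) \<Rightarrow> bool" where
  "computable f \<longleftrightarrow> (\<exists>g. recursive g \<and> (\<forall>x. code (f x) = g (code x)))"

named_theorems computable_intros

lemma computable_comp: "computable f \<Longrightarrow> computable g \<Longrightarrow> computable (\<lambda>x. f (g x))"
  unfolding computable_def using recursive_comp by metis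

lemma computableI: "recursive g \<Longrightarrow> (\<And>x. code (f x) = g (code x)) \<Longrightarrow> computable f"
  unfolding computable_def by blast

lemma computable_id [computable_intros]: "computable (\<lambda>x. x)"
  by (rule computableI[OF recursive_id]) simp

lemma computable_const [computable_intros]: "computable (\<lambda>x. c)"
  by (rule computableI[OF recursive_const[of "code c"]]) simp

lemma computable_Pair [computable_intros]:
  assumes "computable f" "computable g"
  shows "computable (\<lambda>x. (f x, g x))"
proof -
  obtain f' g' where "recursive f'" "\<And>x. code (f x) = f' (code x)"
    "recursive g'" "\<And>x. code (g x) = g' (code x)"
    using assms unfolding computable_def by blast
  then show ?thesis
    by (intro computableI[OF recursive_pair[of f' g']]) (auto simp: code_prod_def)
qed

lemma computable_fst [computable_intros]: "computable f \<Longrightarrow> computable (\<lambda>x. fst (f x))"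
  by (rule computable_comp) (rule computableI[OF recursive_fst], simp add: code_prod_def)

lemma computable_snd [computable_intros]: "computable f \<Longrightarrow> computable (\<lambda>x. snd (f x))"
  by (rule computable_comp) (rule computableI[OF recursive_snd], simp add: code_prod_def)

lemma computable_code [computable_intros]: "computable f \<Longrightarrow> computable (\<lambda>x. code (f x))"
  by (rule computable_comp) (rule computableI[OF recursive_id], simp add: code_nat_def)

lemma computable_decode [computable_intros]: "computable f \<Longrightarrow> computable (\<lambda>x. decode (f x))"
  by (rule computable_comp) (rule computableI[OF recursive_id], simp add: code_nat_def)

text \<open>A natural number is its own code, so functions into any coded type, in particular the
  constructors of lists and formulas, can be treated as functions into the naturals.\<close>

lemma computable_by_code: "computable (\<lambda>x. code (f x)) \<Longrightarrow> computable f"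
  unfolding computable_def by (simp add: code_nat_def)

lemma computable_Suc [computable_intros]: "computable f \<Longrightarrow> computable (\<lambda>x. Suc (f x))"
  by (rule computable_comp) (rule computableI[OF recursive_Suc], simp add: code_nat_def)

lemma computable_prod_encode [computable_intros]:
  "computable f \<Longrightarrow> computable g \<Longrightarrow> computable (\<lambda>x. prod_encode (f x, g x))"
  using computable_code[OF computable_Pair] by (fastforce simp: code_prod_def code_nat_def)

lemma computable_prod_decode [computable_intros]:
  assumes "computable f"
  shows "computable (\<lambda>x. prod_decode (f x))"
proof -
  have "prod_decode n = decode n" for n
    by (subst code_eq_iff[symmetric], subst code_decode) (simp add: code_prod_def code_nat_def)
  then show ?thesis using computable_decode[OF assms] by simp
qed

text \<open>All bounded computation below, from addition to folds over lists, is brought into this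
  form. The step may depend on the argument \<open>x\<close>, whose code primitive recursion carries
  along as its parameter.\<close>

lemma computable_rec_nat [computable_intros]:
  fixes s :: "'a :: coded \<Rightarrow> nat \<Rightarrow> 'b :: coded \<Rightarrow> 'b"
  assumes "computable i" "computable n"
    and "computable (\<lambda>z. s (fst z) (fst (snd z)) (snd (snd z)))"
  shows "computable (\<lambda>x. rec_nat (i x) (s x) (n x))"
proof -
  obtain i' where i': "recursive i'" "\<And>x. code (i x) = i' (code x)"
    using assms(1) unfolding computable_def by blast
  obtain s' where s': "recursive s'"
    "\<And>z. code (s (fst z) (fst (snd z)) (snd (snd z))) = s' (code z)"
    using assms(3) unfolding computable_def by blast
  have s'': "s' (prod_encode (code x, prod_encode (m, code r))) = code (s x m r)" for x m r
    using s'(2)[of "(x, m, r)"] by (simp add: code_prod_def code_nat_def)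
  have "rec_nat (i' (code x)) (\<lambda>m r. s' (prod_encode (code x, prod_encode (m, r)))) n
      = code (rec_nat (i x) (s x) n)" for x n
    by (induction n) (simp_all add: i'(2) s'')
  then have "computable (\<lambda>z. rec_nat (i (fst z)) (s (fst z)) (snd z))"
    by (intro computableI[OF recursive_rec_nat[OF i'(1) s'(1)]])
       (simp add: code_prod_def code_nat_def)
  from computable_comp[OF this computable_Pair[OF computable_id assms(2)]]
  show ?thesis by simp
qed

section \<open>Arithmetic and decidable conditions on natural numbers\<close>

lemma rec_nat_add: "rec_nat a (\<lambda>m r. Suc r) b = a + b"
  by (induction b) auto

lemma rec_nat_mult: "rec_nat 0 (\<lambda>m r. r + a) b = a * b"
  by (induction b) auto

lemma rec_nat_pred: "rec_nat 0 (\<lambda>m r. m) b = b - 1"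
  by (induction b) auto

lemma rec_nat_diff: "rec_nat a (\<lambda>m r. r - 1) b = a - b"
  by (induction b) auto

lemma computable_add_nat [computable_intros]:
  fixes f g :: "_ \<Rightarrow> nat"
  assumes "computable f" "computable g"
  shows "computable (\<lambda>x. f x + g x)"
  unfolding rec_nat_add[symmetric] by (intro computable_intros assms)

lemma computable_mult_nat [computable_intros]:
  fixes f g :: "_ \<Rightarrow> nat"
  assumes "computable f" "computable g"
  shows "computable (\<lambda>x. f x * g x)"
  unfolding rec_nat_mult[symmetric]
  by (intro computable_intros assms computable_comp[OF assms(1)])

lemma computable_pred: "computable f \<Longrightarrow> computable (\<lambda>x. f x - 1 :: nat)"
  by (subst rec_nat_pred[symmetric]) (intro computable_intros)

lemma computable_diff_nat [computable_intros]:
  fixes f g :: "_ \<Rightarrow> nat"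
  assumes "computable f" "computable g"
  shows "computable (\<lambda>x. f x - g x)"
  by (subst rec_nat_diff[symmetric]) (intro computable_rec_nat computable_pred computable_intros assms)

lemma computable_power_nat [computable_intros]:
  fixes f g :: "_ \<Rightarrow> nat"
  assumes "computable f" "computable g"
  shows "computable (\<lambda>x. f x ^ g x)"
proof -
  have "rec_nat 1 (\<lambda>m r. r * a) b = a ^ b" for a b :: nat
    by (induction b) auto
  then have "f x ^ g x = rec_nat 1 (\<lambda>m r. r * f x) (g x)" for x
    by simp
  then show ?thesis
    by (simp only:) (intro computable_intros assms computable_comp[OF assms(1)])
qed

text \<open>A conditional is a recursion of length 0 or 1, the length being the code of the
  condition.\<close>

lemma computable_if [computable_intros]:
  fixes f g :: "_ \<Rightarrow> 'b :: coded"
  assumes "computable b" "computable f" "computable g"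
  shows "computable (\<lambda>x. if b x then f x else g x)"
proof -
  have "(if b x then f x else g x) = rec_nat (g x) (\<lambda>_ _. f x) (code (b x))" for x
    by (simp add: code_bool_def)
  then show ?thesis
    by (simp only:) (intro computable_intros assms computable_comp[OF assms(2)])
qed

lemma computable_not [computable_intros]:
  assumes "computable f"
  shows "computable (\<lambda>x. \<not> f x)"
proof -
  have eq: "(\<lambda>x. \<not> f x) = (\<lambda>x. if f x then False else True)"
    by auto
  show ?thesis unfolding eq by (intro computable_intros assms)
qed

lemma computable_conj [computable_intros]:
  assumes "computable f" "computable g"
  shows "computable (\<lambda>x. f x \<and> g x)"
proof -
  have eq: "(\<lambda>x. f x \<and> g x) = (\<lambda>x. if f x then g x else False)"
    by auto
  show ?thesis unfolding eq by (intro computable_intros assms)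
qed

lemma computable_le_nat [computable_intros]:
  fixes f g :: "_ \<Rightarrow> nat"
  assumes "computable f" "computable g"
  shows "computable (\<lambda>x. f x \<le> g x)"
proof -
  have eq: "(f x \<le> g x) = rec_nat True (\<lambda>_ _. False) (f x - g x)" for x
    by (cases "f x - g x") auto
  show ?thesis unfolding eq by (intro computable_intros assms)
qed

lemma computable_less_nat [computable_intros]:
  fixes f g :: "_ \<Rightarrow> nat"
  shows "computable f \<Longrightarrow> computable g \<Longrightarrow> computable (\<lambda>x. f x < g x)"
  unfolding linorder_not_le[symmetric] by (intro computable_intros)

lemma computable_eq [computable_intros]:
  fixes f g :: "_ \<Rightarrow> 'b :: bicoded"
  assumes "computable f" "computable g"
  shows "computable (\<lambda>x. f x = g x)"
proof -
  have "(f x = g x) = (code (f x) \<le> code (g x) \<and> code (g x) \<le> code (f x))" for x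
    by (metis code_eq_iff le_antisym order_refl)
  then show ?thesis
    by (simp only:) (intro computable_intros assms)
qed

lemma computable_half [computable_intros]:
  assumes "computable f"
  shows "computable (\<lambda>x. f x div 2 :: nat)"
proof -
  \<comment> \<open>Counting up to the argument while keeping the quotient and the remainder modulo
    2.\<close>
  define s :: "nat \<times> nat \<Rightarrow> nat \<times> nat" where
    "s r = (if snd r = 0 then (fst r, 1) else (Suc (fst r), 0))" for r
  have "rec_nat (0, 0) (\<lambda>m. s) n = (n div 2, n mod 2)" for n
    by (induction n) (auto simp: s_def div_Suc mod_Suc)
  then have "f x div 2 = fst (rec_nat (0, 0) (\<lambda>m. s) (f x))" for x
    by simp
  then show ?thesis
    by (simp only:) (unfold s_def, intro computable_intros assms)
qed

lemma computable_even [computable_intros]: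
  assumes "computable f"
  shows "computable (\<lambda>x. even (f x :: nat))"
proof -
  have "even n \<longleftrightarrow> n \<le> n div 2 * 2" for n :: nat
    by presburger
  then show ?thesis
    by (simp only:) (intro computable_intros assms)
qed

lemma computable_div_power2 [computable_intros]:
  assumes "computable f" "computable g"
  shows "computable (\<lambda>x. f x div 2 ^ g x :: nat)"
proof -
  have eq: "n div 2 ^ k = rec_nat n (\<lambda>_ r. r div 2) k" for n k :: nat
    by (induction k) (simp_all add: div_mult2_eq mult.commute[of 2])
  show ?thesis unfolding eq by (intro computable_intros assms)
qed

subsection \<open>Integers\<close>

lemma int_encode_nonneg: "int_encode (int n) = 2 * n"
  by (simp add: int_encode_def sum_encode_def)

lemma int_encode_neg: "0 < n \<Longrightarrow> int_encode (- int n) = 2 * (n - 1) + 1"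
  by (simp add: int_encode_def sum_encode_def nat_diff_distrib')

text \<open>The way back from natural to integer arithmetic: sums and products of integers are
  written as differences of naturals built from positive and negative parts.\<close>

lemma computable_nat_diff:
  assumes "computable f" "computable g"
  shows "computable (\<lambda>x. int (f x) - int (g x))"
proof (rule computable_by_code)
  have "code (int m - int n) = (if n \<le> m then 2 * (m - n) else 2 * (n - m - 1) + 1)" for m n
    using int_encode_nonneg[of "m - n"] int_encode_neg[of "n - m"]
    by (auto simp: code_int_def of_nat_diff)
  then show "computable (\<lambda>x. code (int (f x) - int (g x)))"
    by (simp only:) (intro computable_intros assms)
qed

lemma computable_nat_parts [computable_intros]:
  assumes "computable f"
  shows "computable (\<lambda>x. nat (f x))" "computable (\<lambda>x. nat (- f x))"
proof -
  have *: "nat i = (if odd (code i) then 0 else code i div 2) \<and>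
    nat (- i) = (if odd (code i) then Suc (code i div 2) else 0)" for i :: int
  proof (cases "0 \<le> i")
    case True
    then show ?thesis
      using int_encode_nonneg[of "nat i"] by (simp add: code_int_def)
  next
    case False
    then show ?thesis
      using int_encode_neg[of "nat (- i)"] by (simp add: code_int_def)
  qed
  show "computable (\<lambda>x. nat (f x))"
    by (subst conjunct1[OF *]) (intro computable_intros assms)
  show "computable (\<lambda>x. nat (- f x))"
    by (subst conjunct2[OF *]) (intro computable_intros assms)
qed

lemma computable_add_int [computable_intros]:
  fixes f g :: "_ \<Rightarrow> int"
  assumes "computable f" "computable g"
  shows "computable (\<lambda>x. f x + g x)"
proof -
  have "i + j = int (nat i + nat j) - int (nat (- i) + nat (- j))" for i j :: int
    by simp
  then show ?thesis
    by (simp only:) (intro computable_nat_diff computable_intros assms)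
qed

lemma computable_mult_int [computable_intros]:
  fixes f g :: "_ \<Rightarrow> int"
  assumes "computable f" "computable g"
  shows "computable (\<lambda>x. f x * g x)"
proof -
  have "i * j = int (nat i * nat j + nat (- i) * nat (- j))
      - int (nat i * nat (- j) + nat (- i) * nat j)" for i j :: int
    by (cases "0 \<le> i"; cases "0 \<le> j") simp_all
  then show ?thesis
    by (simp only:) (intro computable_nat_diff computable_intros assms)
qed

lemma computable_abs_int [computable_intros]:
  fixes f :: "_ \<Rightarrow> int"
  assumes "computable f"
  shows "computable (\<lambda>x. nat \<bar>f x\<bar>)"
proof -
  have "nat \<bar>i\<bar> = nat i + nat (- i)" for i :: int
    by simp
  then show ?thesis
    by (simp only:) (intro computable_intros assms)
qed

subsection \<open>Lists\<close>

lemma code_Cons: "code (x # xs) = Suc (prod_encode (code x, code xs))"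
  by (simp add: code_list_def)

lemma code_Nil: "code ([] :: 'a :: coded list) = 0"
  by (simp add: code_list_def)

lemma computable_Cons [computable_intros]:
  assumes "computable f" "computable g"
  shows "computable (\<lambda>x. f x # g x)"
  by (rule computable_by_code, simp only: code_Cons) (intro computable_intros assms)

lemma length_le_code: "length xs \<le> code xs"
proof (induction xs)
  case (Cons x xs)
  then show ?case
    using le_prod_encode_2[of "code xs" "code x"] by (simp add: code_Cons)
qed (simp add: code_Nil)

text \<open>The state consists of the code of the unread rest and the accumulator. The number of
  iterations is the code of the list itself, which is at least its length; surplus steps do nothing,
  as the empty list has code 0 and the step leaves such a state alone.\<close>

lemma computable_foldl [computable_intros]:
  fixes l :: "'a :: coded \<Rightarrow> 'b :: bicoded list" and i :: "'a \<Rightarrow> 'c :: coded"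
  assumes "computable i" "computable l"
    and "computable (\<lambda>z. f (fst z) (fst (snd z)) (snd (snd z)))"
  shows "computable (\<lambda>x. foldl (f x) (i x) (l x))"
proof -
  \<comment> \<open>The hypothesis speaks of projections of a triple; this restatement for arbitrary
    computable arguments is what the introduction rules can apply under binders.\<close>
  have F: "computable (\<lambda>z. f (a z) (b z) (c z))"
    if "computable a" "computable b" "computable c" for a :: "'d :: coded \<Rightarrow> _" and b c
    using computable_comp[OF assms(3) computable_Pair[OF that(1) computable_Pair[OF that(2,3)]]]
    by simp
  define s :: "'a \<Rightarrow> nat \<times> 'c \<Rightarrow> nat \<times> 'c" where
    "s x r = (if fst r = 0 then r else
       (snd (prod_decode (fst r - 1)), f x (snd r) (decode (fst (prod_decode (fst r - 1))))))" for x r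
  have "length xs \<le> n \<Longrightarrow> (s x ^^ n) (code xs, a) = (0, foldl (f x) a xs)" for x n xs a
  proof (induction n arbitrary: xs a)
    case 0
    then show ?case by (simp add: code_Nil)
  next
    case (Suc n)
    then show ?case
      using Suc.IH[of "[]"]
      by (cases xs) (simp_all add: funpow_Suc_right s_def code_Nil code_Cons del: funpow.simps)
  qed
  moreover have "(s x ^^ n) a = rec_nat a (\<lambda>m. s x) n" for x n a
    by (induction n) auto
  ultimately have "foldl (f x) (i x) (l x) =
      snd (rec_nat (code (l x), i x) (\<lambda>m. s x) (code (l x)))" for x
    using length_le_code[of "l x"] by (metis snd_conv)
  moreover have "computable (\<lambda>x. snd (rec_nat (code (l x), i x) (\<lambda>m. s x) (code (l x))))"
    unfolding s_def
    by (intro computable_intros assms F)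
  ultimately show ?thesis by simp
qed

lemma computable_rev [computable_intros]:
  fixes f :: "_ \<Rightarrow> 'b :: bicoded list"
  assumes "computable f"
  shows "computable (\<lambda>x. rev (f x))"
proof -
  have eq: "rev xs = foldl (\<lambda>a y. y # a) [] xs" for xs :: "'b list"
    by (simp add: foldl_conv_fold rev_conv_fold)
  show ?thesis unfolding eq by (intro computable_intros assms)
qed

lemma computable_foldr [computable_intros]:
  fixes l :: "'a :: coded \<Rightarrow> 'b :: bicoded list" and i :: "'a \<Rightarrow> 'c :: coded"
  assumes "computable i" "computable l"
    and "computable (\<lambda>z. f (fst z) (fst (snd z)) (snd (snd z)))"
  shows "computable (\<lambda>x. foldr (f x) (l x) (i x))"
proof -
  have "computable (\<lambda>z. f (fst z) (snd (snd z)) (fst (snd z)))"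
    using computable_comp[OF assms(3), of "\<lambda>z. (fst z, snd (snd z), fst (snd z))"]
    by (simp add: computable_intros)
  then show ?thesis
    unfolding foldr_conv_foldl by (intro computable_intros assms)
qed

lemma computable_map [computable_intros]:
  fixes l :: "'a :: coded \<Rightarrow> 'b :: bicoded list" and f :: "'a \<Rightarrow> 'b \<Rightarrow> 'c :: coded"
  assumes "computable l" "computable (\<lambda>z. f (fst z) (snd z))"
  shows "computable (\<lambda>x. map (f x) (l x))"
proof -
  have eq: "map g xs = foldr (\<lambda>y a. g y # a) xs []" for g :: "'b \<Rightarrow> 'c" and xs
    by (induction xs) auto
  have F: "computable (\<lambda>z. f (a z) (b z))"
    if "computable a" "computable b" for a :: "'d :: coded \<Rightarrow> _" and b
    using computable_comp[OF assms(2) computable_Pair[OF that]] by simp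
  show ?thesis unfolding eq by (intro computable_intros assms F)
qed

lemma computable_append [computable_intros]:
  fixes f g :: "_ \<Rightarrow> 'b :: bicoded list"
  assumes "computable f" "computable g"
  shows "computable (\<lambda>x. f x @ g x)"
proof -
  have eq: "xs @ ys = foldr (\<lambda>y a. y # a) xs ys" for xs ys :: "'b list"
    by (induction xs) auto
  show ?thesis unfolding eq by (intro computable_intros assms)
qed

lemma computable_concat [computable_intros]:
  fixes f :: "_ \<Rightarrow> 'b :: bicoded list list"
  assumes "computable f"
  shows "computable (\<lambda>x. concat (f x))"
  unfolding concat_conv_foldr by (intro computable_intros assms)

lemma computable_length [computable_intros]:
  fixes f :: "_ \<Rightarrow> 'b :: bicoded list"
  assumes "computable f"
  shows "computable (\<lambda>x. length (f x))"
proof -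
  have eq: "length xs = foldr (\<lambda>_ a. Suc a) xs 0" for xs :: "'b list"
    by (induction xs) auto
  show ?thesis unfolding eq by (intro computable_intros assms)
qed

lemma computable_upt [computable_intros]:
  assumes "computable f" "computable g"
  shows "computable (\<lambda>x. [f x..<g x])"
proof -
  have eq: "[m..<n] = rec_nat [] (\<lambda>k r. if m \<le> k then r @ [k] else r) n" for m n
    by (induction n) auto
  have F: "computable (\<lambda>z. f (a z))" if "computable a" for a :: "'d :: coded \<Rightarrow> _"
    using computable_comp[OF assms(1) that] .
  show ?thesis unfolding eq by (intro computable_intros assms F)
qed

lemma computable_sum_list [computable_intros]:
  fixes f :: "_ \<Rightarrow> int list"
  assumes "computable f"
  shows "computable (\<lambda>x. sum_list (f x))"
  unfolding sum_list.eq_foldr by (intro computable_intros assms)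

lemma computable_Ball_set [computable_intros]:
  fixes l :: "'a :: coded \<Rightarrow> 'b :: bicoded list"
  assumes "computable l" "computable (\<lambda>z. P (fst z) (snd z))"
  shows "computable (\<lambda>x. \<forall>y\<in>set (l x). P x y)"
proof -
  have eq: "(\<forall>y\<in>set xs. Q y) = foldr (\<lambda>y a. Q y \<and> a) xs True" for Q and xs :: "'b list"
    by (induction xs) auto
  have F: "computable (\<lambda>z. P (a z) (b z))"
    if "computable a" "computable b" for a :: "'d :: coded \<Rightarrow> _" and b
    using computable_comp[OF assms(2) computable_Pair[OF that]] by simp
  show ?thesis unfolding eq by (intro computable_intros assms F)
qed

lemma computable_in_set [computable_intros]:
  fixes l :: "'a :: coded \<Rightarrow> 'b :: bicoded list"
  assumes "computable f" "computable l"
  shows "computable (\<lambda>x. f x \<in> set (l x))"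
proof -
  have eq: "y \<in> set xs \<longleftrightarrow> \<not> (\<forall>z\<in>set xs. y \<noteq> z)" for y and xs :: "'b list"
    by auto
  have F: "computable (\<lambda>z. f (a z))" if "computable a" for a :: "'d :: coded \<Rightarrow> _"
    using computable_comp[OF assms(1) that] .
  show ?thesis unfolding eq by (intro computable_intros assms F)
qed

lemma computable_insert [computable_intros]:
  fixes l :: "'a :: coded \<Rightarrow> 'b :: bicoded list"
  assumes "computable f" "computable l"
  shows "computable (\<lambda>x. List.insert (f x) (l x))"
  unfolding List.insert_def by (intro computable_intros assms)

text \<open>Indexing with a default: beyond the end of a list \<open>!\<close> has no provable
  value, while a computable function needs a known value at every argument, malformed codes
  included.\<close>

definition fetch :: "'a \<Rightarrow> 'a list \<Rightarrow> nat \<Rightarrow> 'a" where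
  "fetch z xs i = (if i < length xs then xs ! i else z)"

lemma computable_fetch [computable_intros]:
  fixes l :: "'a :: coded \<Rightarrow> 'b :: bicoded list"
  assumes "computable d" "computable l" "computable n"
  shows "computable (\<lambda>x. fetch (d x) (l x) (n x))"
proof -
  have "foldl (\<lambda>s y. (Suc (fst s), if fst s = i then y else snd s)) (0, z) xs
      = (length xs, fetch z xs i)" for i xs and z :: 'b
    by (induction xs rule: rev_induct) (auto simp: fetch_def nth_append)
  then have eq: "fetch z xs i =
      snd (foldl (\<lambda>s y. (Suc (fst s), if fst s = i then y else snd s)) (0, z) xs)"
    for i xs and z :: 'b
    by simp
  have F: "computable (\<lambda>z. n (a z))" if "computable a" for a :: "'d :: coded \<Rightarrow> _"
    using computable_comp[OF assms(3) that] .
  show ?thesis unfolding eq by (intro computable_intros assms F)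
qed

subsection \<open>Formulas\<close>

lemma computable_PVar [computable_intros]:
  assumes "computable f"
  shows "computable (\<lambda>x. PVar (f x))"
  by (rule computable_by_code, simp only: code_pterm_def tcode.simps)
     (intro computable_intros assms)

lemma computable_PAdd [computable_intros]:
  assumes "computable f" "computable g"
  shows "computable (\<lambda>x. PAdd (f x) (g x))"
  by (rule computable_by_code, simp only: code_pterm_def tcode.simps, fold code_pterm_def)
     (intro computable_intros assms)

lemma computable_atoms [computable_intros]:
  assumes "computable f" "computable g"
  shows "computable (\<lambda>x. PLess (f x) (g x))" "computable (\<lambda>x. PEq (f x) (g x))"
  by (rule computable_by_code, simp only: code_pform_def fcode.simps, fold code_pterm_def,
      intro computable_intros assms)+

lemma computable_PNot [computable_intros]:
  assumes "computable f"
  shows "computable (\<lambda>x. PNot (f x))"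
  by (rule computable_by_code, simp only: code_pform_def fcode.simps, fold code_pform_def)
     (intro computable_intros assms)

lemma computable_connectives [computable_intros]:
  assumes "computable f" "computable g"
  shows "computable (\<lambda>x. PAnd (f x) (g x))" "computable (\<lambda>x. POr (f x) (g x))"
  by (rule computable_by_code, simp only: code_pform_def fcode.simps, fold code_pform_def,
      intro computable_intros assms)+

lemma computable_PEx [computable_intros]:
  assumes "computable f" "computable g"
  shows "computable (\<lambda>x. PEx (f x) (g x))"
  by (rule computable_by_code, simp only: code_pform_def fcode.simps, fold code_pform_def)
     (intro computable_intros assms)

subsection \<open>Unbounded search\<close>

text \<open>The only use of minimisation. The tested predicate is total, so the search stops as soon
  as one witness exists, and it returns the least.\<close>

lemma partial_recursive_search:
  fixes P :: "'a :: coded \<Rightarrow> nat \<Rightarrow> bool" and G :: "'a \<Rightarrow> nat \<Rightarrow> 'b :: coded"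
  assumes "computable (\<lambda>z. P (fst z) (snd z))" "computable (\<lambda>z. G (fst z) (snd z))"
  obtains F where "partial_recursive F"
    "\<And>x n. P x n \<Longrightarrow> F (code x) = Some (code (G x (LEAST n. P x n)))"
proof -
  \<comment> \<open>Minimisation looks for the value 0, which is the code of \<open>False\<close>;
    hence the negation.\<close>
  obtain P' where P': "recursive P'" "\<And>z. code (\<not> P (fst z) (snd z)) = P' (code z)"
    using computable_not[OF assms(1)] unfolding computable_def by blast
  obtain G' where G': "recursive G'" "\<And>z. code (G (fst z) (snd z)) = G' (code z)"
    using assms(2) unfolding computable_def by blast
  have P'': "P' (prod_encode (code x, n)) = of_bool (\<not> P x n)" for x n
    using P'(2)[of "(x, n)"] by (simp add: code_prod_def code_nat_def code_bool_def)
  have G'': "G' (prod_encode (code x, n)) = code (G x n)" for x n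
    using G'(2)[of "(x, n)"] by (simp add: code_prod_def code_nat_def)
  define M where "M a = (if \<exists>n. P' (prod_encode (a, n)) = 0
    then Some (LEAST n. P' (prod_encode (a, n)) = 0) else None)" for a
  have M: "partial_recursive M"
    using partial_recursive.minimise[OF P'(1)[unfolded recursive_def]]
    unfolding M_def option.inject by simp
  have "partial_recursive (\<lambda>a. Option.bind (M a) (\<lambda>n. Some (prod_encode (a, n))))"
    using partial_recursive.pair[OF recursive_id[unfolded recursive_def] M] by simp
  from partial_recursive.comp[OF G'(1)[unfolded recursive_def] this]
  show ?thesis
    by (rule that) (auto simp: M_def P'' G'')
qed

section \<open>Walks and flows\<close>

text \<open>Edges are indices with their ends given by functions, so parallel edges stay distinct
  and multiplicities are functions of the index.\<close>

fun walk :: "(nat \<Rightarrow> 'n) \<Rightarrow> (nat \<Rightarrow> 'n) \<Rightarrow> 'n \<Rightarrow> nat list \<Rightarrow> 'n \<Rightarrow> bool" where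
  "walk src tgt s [] t \<longleftrightarrow> s = t"
| "walk src tgt s (i # is) t \<longleftrightarrow> src i = s \<and> walk src tgt (tgt i) is t"

lemma walk_append:
  "walk src tgt s (is @ js) t \<longleftrightarrow> (\<exists>m. walk src tgt s is m \<and> walk src tgt m js t)"
  by (induction "is" arbitrary: s) auto

definition through :: "nat set \<Rightarrow> (nat \<Rightarrow> 'n) \<Rightarrow> (nat \<Rightarrow> nat) \<Rightarrow> 'n \<Rightarrow> nat" where
  "through I end x n = (\<Sum>i\<in>I. if end i = n then x i else 0)"

text \<open>Kirchhoff's law with a unit entering at \<open>s\<close> and leaving at
  \<open>t\<close>, written without subtraction. For \<open>s = t\<close> the units cancel, so
  closed walks need no separate treatment.\<close>

definition flow :: "nat set \<Rightarrow> (nat \<Rightarrow> 'n) \<Rightarrow> (nat \<Rightarrow> 'n) \<Rightarrow> (nat \<Rightarrow> nat) \<Rightarrow> 'n \<Rightarrow> 'n \<Rightarrow> bool" where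
  "flow I src tgt x s t \<longleftrightarrow>
     (\<forall>n. through I src x n + of_bool (n = t) = through I tgt x n + of_bool (n = s))"

lemma through_Suc:
  assumes "finite I" "i \<in> I"
  shows "through I end (x(i := Suc (x i))) n = through I end x n + of_bool (end i = n)"
proof -
  have "(\<Sum>j\<in>I - {i}. if end j = n then (x(i := Suc (x i))) j else 0)
      = (\<Sum>j\<in>I - {i}. if end j = n then x j else 0)"
    by (intro sum.cong) auto
  then show ?thesis
    using assms by (simp add: through_def sum.remove[of I i])
qed

lemma flow_cong: "(\<And>i. i \<in> I \<Longrightarrow> x i = y i) \<Longrightarrow> flow I src tgt x s t = flow I src tgt y s t"
  unfolding flow_def through_def by (simp cong: if_cong sum.cong)

lemma through_add: "through I end (\<lambda>i. x i + y i) n = through I end x n + through I end y n"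
  by (simp add: through_def sum.distrib[symmetric]) (intro sum.cong, auto)

text \<open>Spending one use of an edge that leaves the source moves the source along it; both
  building a flow from a walk and peeling a walk off a flow rest on this.\<close>

lemma flow_cons:
  assumes "finite I" "i \<in> I" "src i = s"
  shows "flow I src tgt (x(i := Suc (x i))) s t \<longleftrightarrow> flow I src tgt x (tgt i) t"
  using assms by (auto simp: flow_def through_Suc eq_commute)

lemma flow_walk:
  assumes "finite I" "walk src tgt s is t" "set is \<subseteq> I"
  shows "flow I src tgt (count_list is) s t"
  using assms(2,3)
proof (induction "is" arbitrary: s)
  case Nil
  then show ?case by (simp add: flow_def through_def)
next
  case (Cons i "is")
  have eq: "count_list (i # is) = (count_list is)(i := Suc (count_list is i))"
    by auto
  show ?case
    using Cons flow_cons[OF assms(1), of i src s tgt "count_list is" t] by (subst eq) simp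
qed

text \<open>The units at the two ends cancel, so what remains is a circulation, which is a flow from
  any node \<open>m\<close> to itself.\<close>

lemma flow_diff:
  assumes "flow I src tgt (\<lambda>i. x i + y i) s t" "flow I src tgt x s t"
  shows "flow I src tgt y m m"
  unfolding flow_def
proof
  fix n
  show "through I src y n + of_bool (n = m) = through I tgt y n + of_bool (n = m)"
    using assms[unfolded flow_def, rule_format, of n] by (simp add: through_add)
qed

lemma flow_imp_walk:
  assumes "finite I" "flow I src tgt x s t"
  shows "\<exists>is. walk src tgt s is t \<and> set is \<subseteq> I \<and> (\<forall>i\<in>I. count_list is i \<le> x i)"
  using assms(2)
proof (induction "\<Sum>i\<in>I. x i" arbitrary: x s rule: less_induct)
  case less
  show ?case
  proof (cases "s = t")
    case True
    then show ?thesis by (intro exI[of _ "[]"]) simp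
  next
    case False
    \<comment> \<open>At \<open>s\<close>, which differs from \<open>t\<close>, the balance makes
      the outflow one more than the inflow.\<close>
    then have "through I src x s \<noteq> 0"
      using less.prems[unfolded flow_def, rule_format, of s] by simp
    then have "\<not> (\<forall>i\<in>I. (if src i = s then x i else 0) = 0)"
      using sum.neutral[of I "\<lambda>i. if src i = s then x i else 0"] unfolding through_def by argo
    then obtain i where i: "i \<in> I" "src i = s" "0 < x i"
      by (auto split: if_splits)
    define y where "y = x(i := x i - 1)"
    have x: "x = y(i := Suc (y i))"
      using i by (auto simp: y_def)
    have "flow I src tgt y (tgt i) t"
      using less.prems x flow_cons[where I = I and i = i and src = src and tgt = tgt and x = y] assms(1) i
      by simp
    moreover have "(\<Sum>i\<in>I. y i) < (\<Sum>i\<in>I. x i)"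
      using i assms(1) by (intro sum_strict_mono_ex1) (auto simp: y_def)
    ultimately obtain "is" where "is": "walk src tgt (tgt i) is t" "set is \<subseteq> I"
      "\<forall>i\<in>I. count_list is i \<le> y i"
      using less.hyps by blast
    then show ?thesis
      using i by (intro exI[of _ "i # is"]) (auto simp: y_def)
  qed
qed

lemma sum_count_list_le:
  assumes "finite I" "set is \<subseteq> I"
  shows "length is = (\<Sum>i\<in>I. count_list is i)"
proof -
  have "(\<Sum>i\<in>I. count_list is i) = (\<Sum>i\<in>set is. count_list is i)"
    using assms by (intro sum.mono_neutral_right) (auto simp: count_list_0_iff)
  then show ?thesis by (simp add: sum_count_set)
qed

text \<open>
  A longest walk respecting the flow uses it up: by conservation an unused edge starting on the
  walk lies on a closed walk of unused edges, which could be spliced in, and the ranks propagate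
  the absence of such edges from the source to the whole support.
\<close>

lemma flow_rank_imp_walk:
  fixes z :: "nat \<Rightarrow> nat"
  assumes "finite I" and x: "flow I src tgt x s t"
    and rank: "\<And>i. i \<in> I \<Longrightarrow> 0 < x i \<Longrightarrow>
      src i = s \<or> (\<exists>j\<in>I. tgt j = src i \<and> 0 < x j \<and> z j < z i)"
  shows "\<exists>is. walk src tgt s is t \<and> set is \<subseteq> I \<and> (\<forall>i\<in>I. count_list is i = x i)"
proof -
  define W where "W is \<longleftrightarrow> walk src tgt s is t \<and> set is \<subseteq> I \<and> (\<forall>i\<in>I. count_list is i \<le> x i)"
    for "is"
  have bound: "length is < Suc (\<Sum>i\<in>I. x i)" if "W is" for "is"
    using that sum_count_list_le[OF assms(1), of "is"] sum_mono[of I "count_list is" x]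
    by (auto simp: W_def)
  obtain is0 where "W is0"
    using flow_imp_walk[OF assms(1) x] by (auto simp: W_def)
  then obtain "is" where "is": "W is" and longest: "\<And>js. W js \<Longrightarrow> length js \<le> length is"
    using ex_has_greatest_nat[of W is0 length "Suc (\<Sum>i\<in>I. x i)"] bound by blast
  define y where "y i = x i - count_list is i" for i
  have xy: "count_list is i + y i = x i" if "i \<in> I" for i
    using "is" that by (simp add: W_def y_def)
  have "flow I src tgt (\<lambda>i. count_list is i + y i) s t"
    by (subst flow_cong[where y = x]) (simp_all add: x xy)
  then have y: "flow I src tgt y m m" for m
    using flow_diff[of I src tgt "count_list is" y s t m] flow_walk[of I src tgt s "is" t] assms(1) "is"
    by (simp add: W_def)
  have saturated: "y i = 0"
    if "i \<in> I" "is = is1 @ is2" "walk src tgt s is1 (src i)" "walk src tgt (src i) is2 t" for i is1 is2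
  proof (rule ccontr)
    assume "y i \<noteq> 0"
    then have "y = (y(i := y i - 1))(i := Suc ((y(i := y i - 1)) i))"
      by auto
    \<comment> \<open>Taking one use of \<open>i\<close> out of the circulation leaves a flow from
      the end of \<open>i\<close> back to its start, which yields the walk closing the
      cycle.\<close>
    then have "flow I src tgt (y(i := y i - 1)) (tgt i) (src i)"
      using y[of "src i"] flow_cons[where I = I and i = i and src = src and x = "y(i := y i - 1)"]
        assms(1) that(1) by metis
    then obtain c where c: "walk src tgt (tgt i) c (src i)" "set c \<subseteq> I"
      "\<forall>j\<in>I. count_list c j \<le> (y(i := y i - 1)) j"
      using flow_imp_walk[OF assms(1), of src tgt "y(i := y i - 1)" "tgt i" "src i"] by blast
    have "count_list (is1 @ (i # c) @ is2) j \<le> x j" if "j \<in> I" for j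
    proof -
      have "count_list is j = count_list is1 j + count_list is2 j"
        using \<open>is = is1 @ is2\<close> by simp
      then show ?thesis
        using xy[OF that] c(3)[rule_format, OF that] \<open>y i \<noteq> 0\<close> by (cases "i = j") simp_all
    qed
    then have "W (is1 @ (i # c) @ is2)"
      using that c "is" by (auto simp: W_def walk_append simp del: append_Cons)
    from longest[OF this] show False
      using \<open>is = is1 @ is2\<close> by simp
  qed
  have "y i = 0" if "i \<in> I" "0 < x i" for i
    using that
  proof (induction "z i" arbitrary: i rule: less_induct)
    case less
    consider "src i = s" | j where "j \<in> I" "tgt j = src i" "0 < x j" "z j < z i"
      using rank[OF less.prems] by blast
    then show ?case
    proof cases
      case 1
      then show ?thesis
        using saturated[of i "[]" "is"] less.prems "is" by (simp add: W_def)
    next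
      case 2
      then have "y j = 0"
        using less.hyps by blast
      \<comment> \<open>Being used up with positive multiplicity, \<open>j\<close> occurs on the
        walk, which therefore visits its end \<open>src i\<close>.\<close>
      then have "count_list is j \<noteq> 0"
        using xy[OF \<open>j \<in> I\<close>] \<open>0 < x j\<close> by simp
      then obtain is1 is2 where split: "is = is1 @ j # is2"
        by (metis count_list_0_iff split_list)
      then show ?thesis
        using saturated[of i "is1 @ [j]" is2] less.prems "is" 2 by (auto simp: W_def walk_append)
    qed
  qed
  then have "count_list is i = x i" if "i \<in> I" for i
    using xy[OF that] that by (cases "x i = 0") auto
  then show ?thesis
    using "is" by (auto simp: W_def)
qed

text \<open>Edges are ranked by their first use: unless it opens the walk, a first use is preceded
  by an edge that ends where it starts and already has a rank. Repeated uses change nothing.\<close>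

lemma walk_imp_rank:
  assumes "walk src tgt s is t"
  shows "\<exists>z :: nat \<Rightarrow> nat. \<forall>i\<in>set is. src i = s \<or> (\<exists>j\<in>set is. tgt j = src i \<and> z j < z i)"
  using assms
proof (induction "is" arbitrary: t rule: rev_induct)
  case Nil
  then show ?case by simp
next
  case (snoc i "is")
  then obtain m where m: "walk src tgt s is m" "src i = m"
    by (auto simp: walk_append)
  obtain z :: "nat \<Rightarrow> nat" where
    z: "\<forall>i\<in>set is. src i = s \<or> (\<exists>j\<in>set is. tgt j = src i \<and> z j < z i)"
    using snoc.IH[OF m(1)] by blast
  have last: "m = s \<or> (\<exists>j\<in>set is. tgt j = m)"
    using m(1) by (cases "is" rule: rev_exhaust) (auto simp: walk_append)
  show ?case
  proof (cases "i \<in> set is")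
    case True
    then have "set (is @ [i]) = set is"
      by auto
    then show ?thesis using z by blast
  next
    case False
    \<comment> \<open>One more than a sum of naturals exceeds each of them, so the new edge is
      ranked above all earlier ones.\<close>
    define z' where "z' = z(i := Suc (\<Sum>j\<in>set is. z j))"
    have "z j < z' i" if "j \<in> set is" for j
      using that member_le_sum[of j "set is" z] by (simp add: z'_def)
    moreover have "z' j = z j" if "j \<in> set is" for j
      using that False by (auto simp: z'_def)
    ultimately have "\<forall>k\<in>set (is @ [i]). src k = s \<or> (\<exists>j\<in>set (is @ [i]). tgt j = src k \<and> z' j < z' k)"
      using z last m(2) by simp metis
    then show ?thesis by (intro exI[of _ z'])
  qed
qed

section \<open>The formula\<close>

definition psum :: "('a \<Rightarrow> pterm) \<Rightarrow> 'a list \<Rightarrow> pterm" where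
  "psum f xs = foldr (\<lambda>x. PAdd (f x)) xs PZero"

definition pconj :: "('a \<Rightarrow> pform) \<Rightarrow> 'a list \<Rightarrow> pform" where
  "pconj f xs = foldr (\<lambda>x. PAnd (f x)) xs (PEq PZero PZero)"

definition pdisj :: "('a \<Rightarrow> pform) \<Rightarrow> 'a list \<Rightarrow> pform" where
  "pdisj f xs = foldr (\<lambda>x. POr (f x)) xs (PLess PZero PZero)"

lemma teval_psum [simp]: "teval e (psum f xs) = (\<Sum>x\<leftarrow>xs. teval e (f x))"
  by (induction xs) (simp_all add: psum_def)

lemma holds_pconj [simp]: "holds e (pconj f xs) \<longleftrightarrow> (\<forall>x\<in>set xs. holds e (f x))"
  by (induction xs) (simp_all add: pconj_def)

lemma holds_pdisj [simp]: "holds e (pdisj f xs) \<longleftrightarrow> (\<exists>x\<in>set xs. holds e (f x))"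
  by (induction xs) (simp_all add: pdisj_def)

lemma tvars_psum [simp]: "tvars (psum f xs) = (\<Union>x\<in>set xs. tvars (f x))"
  by (induction xs) (simp_all add: psum_def)

lemma free_vars_pconj [simp]: "free_vars (pconj f xs) = (\<Union>x\<in>set xs. free_vars (f x))"
  by (induction xs) (simp_all add: pconj_def)

lemma free_vars_pdisj [simp]: "free_vars (pdisj f xs) = (\<Union>x\<in>set xs. free_vars (f x))"
  by (induction xs) (simp_all add: pdisj_def)

lemma quantifier_free_pconj [simp]:
  "quantifier_free (pconj f xs) \<longleftrightarrow> (\<forall>x\<in>set xs. quantifier_free (f x))"
  by (induction xs) (simp_all add: pconj_def)

lemma quantifier_free_pdisj [simp]:
  "quantifier_free (pdisj f xs) \<longleftrightarrow> (\<forall>x\<in>set xs. quantifier_free (f x))"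
  by (induction xs) (simp_all add: pdisj_def)

lemma holds_foldr_PEx:
  "holds e (foldr PEx zs f) \<longleftrightarrow> (\<exists>e'. (\<forall>i. i \<notin> set zs \<longrightarrow> e' i = e i) \<and> holds e' f)"
proof (induction zs arbitrary: e)
  case Nil
  have "(\<forall>i. e' i = e i) \<longleftrightarrow> e' = e" for e'
    by auto
  then show ?case by simp
next
  case (Cons z zs)
  have "(\<exists>a. \<forall>i. i \<notin> set zs \<longrightarrow> e' i = (e(z := a)) i) \<longleftrightarrow> (\<forall>i. i \<notin> set (z # zs) \<longrightarrow> e' i = e i)"
    for e'
    by (auto intro: exI[of _ "e' z"])
  then show ?case
    by (simp add: Cons.IH) blast
qed

lemma free_vars_foldr_PEx: "free_vars (foldr PEx zs f) = free_vars f - set zs"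
  by (induction zs) auto

text \<open>Induction splits off the lowest bit; the other digits are those of
  \<open>n div 2\<close> and weigh twice as much, which is why \<open>a\<close> is
  generalised.\<close>

lemma sum_binary_digits:
  "n < 2 ^ K \<Longrightarrow> (\<Sum>k<K. if even (n div 2 ^ k) then 0 else 2 ^ k * a) = int n * a"
proof (induction K arbitrary: n a)
  case 0
  then show ?case by simp
next
  case (Suc K)
  have "(\<Sum>k<Suc K. if even (n div 2 ^ k) then 0 else 2 ^ k * a)
      = (if even n then 0 else a)
        + (\<Sum>k<K. if even (n div 2 div 2 ^ k) then 0 else 2 ^ k * (2 * a))"
    by (simp only: sum.lessThan_Suc_shift)
       (simp add: div_mult2_eq algebra_simps cong: if_cong)
  also have "\<dots> = (if even n then 0 else a) + int (n div 2) * (2 * a)"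
    using Suc.prems by (subst Suc.IH) auto
  also have "\<dots> = (int (n mod 2) + 2 * int (n div 2)) * a"
    by (auto simp: algebra_simps even_iff_mod_2_eq_zero odd_iff_mod_2_eq_one)
  also have "int (n mod 2) + 2 * int (n div 2) = int n"
    by presburger
  finally show ?case .
qed

text \<open>
  The index \<open>y + k * B\<close> with \<open>y < B\<close> and \<open>k < K\<close> is that of a variable for \<open>2 ^ k\<close> times the
  variable with index \<open>y\<close>, so that the multiple by a natural number below \<open>2 ^ K\<close> is a sum
  of at most \<open>K\<close> variables.
\<close>

definition scaled :: "nat \<Rightarrow> nat \<Rightarrow> nat \<Rightarrow> nat \<Rightarrow> pterm" where
  "scaled B K n y = psum (\<lambda>k. if even (n div 2 ^ k) then PZero else PVar (y + k * B)) [0..<K]"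

text \<open>A shift of the index by \<open>B\<close> stands for doubling, uniformly for the free
  variables, the counts and the ranks, all of which have indices below \<open>B\<close>.\<close>

definition doubling :: "nat \<Rightarrow> nat \<Rightarrow> pform" where
  "doubling B K = pconj (\<lambda>j. PEq (PVar (j + B)) (PAdd (PVar j) (PVar j))) [0..<K * B]"

lemma doubling_power:
  assumes "holds e (doubling B K)" "y < B" "k \<le> K"
  shows "e (y + k * B) = 2 ^ k * e y"
  using assms(3)
proof (induction k)
  case (Suc k)
  have "y + k * B < Suc k * B"
    using assms(2) by simp
  also have "\<dots> \<le> K * B"
    using Suc.prems by (rule mult_right_mono) simp
  finally have "e (y + k * B + B) = e (y + k * B) + e (y + k * B)"
    using assms(1) by (simp add: doubling_def)
  with Suc show ?case by (simp add: algebra_simps)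
qed simp

lemma teval_scaled:
  assumes "holds e (doubling B K)" "y < B" "n < 2 ^ K"
  shows "teval e (scaled B K n y) = int n * e y"
proof -
  have "teval e (scaled B K n y) = (\<Sum>k<K. if even (n div 2 ^ k) then 0 else 2 ^ k * e y)"
    unfolding scaled_def teval_psum
    by (subst sum.list_conv_set_nth)
       (auto simp: atLeast0LessThan doubling_power[OF assms(1,2)] intro!: sum.cong)
  then show ?thesis
    using sum_binary_digits[OF assms(3)] by simp
qed

text \<open>
  For a list of weighted edges, variable \<open>2 * d + i\<close> is the number of uses of the \<open>i\<close>-th edge
  and variable \<open>2 * d + length es + i\<close> is its rank: a used edge that does not start at the
  source \<open>s\<close> has to start where some used edge of smaller rank ends.
\<close>

type_synonym 'n edge = "'n \<times> int list \<times> 'n"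

definition edge_src :: "'n \<Rightarrow> 'n edge list \<Rightarrow> nat \<Rightarrow> 'n" where
  "edge_src s es i = fst (fetch (s, [], s) es i)"

definition edge_weight :: "'n \<Rightarrow> 'n edge list \<Rightarrow> nat \<Rightarrow> int list" where
  "edge_weight s es i = fst (snd (fetch (s, [], s) es i))"

definition edge_tgt :: "'n \<Rightarrow> 'n edge list \<Rightarrow> nat \<Rightarrow> 'n" where
  "edge_tgt s es i = snd (snd (fetch (s, [], s) es i))"

definition nonneg :: "nat \<Rightarrow> nat \<Rightarrow> pform" where
  "nonneg m n = pconj (\<lambda>j. PNot (PLess (PVar j) PZero)) [m..<n]"

definition ranked :: "nat \<Rightarrow> 'n edge list \<Rightarrow> 'n \<Rightarrow> pform" where
  "ranked d es s = pconj (\<lambda>i. POr (PEq (PVar (2 * d + i)) PZero)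
     (if edge_src s es i = s then PEq PZero PZero
      else pdisj (\<lambda>j. if edge_tgt s es j = edge_src s es i
             then PAnd (PLess PZero (PVar (2 * d + j)))
                    (PLess (PVar (2 * d + length es + j)) (PVar (2 * d + length es + i)))
             else PLess PZero PZero) [0..<length es])) [0..<length es]"

text \<open>At a node that is neither \<open>s\<close> nor \<open>t\<close> nor an end of an edge
  both sides vanish, so finitely many equations express the balance everywhere.\<close>

definition conserved :: "nat \<Rightarrow> 'n edge list \<Rightarrow> 'n \<Rightarrow> 'n \<Rightarrow> pform" where
  "conserved d es s t = pconj (\<lambda>n. PEq
     (PAdd (psum (\<lambda>i. if edge_src s es i = n then PVar (2 * d + i) else PZero) [0..<length es])
       (if n = t then POne else PZero))
     (PAdd (psum (\<lambda>i. if edge_tgt s es i = n then PVar (2 * d + i) else PZero) [0..<length es])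
       (if n = s then POne else PZero)))
     (s # t # map fst es @ map (\<lambda>x. snd (snd x)) es)"

text \<open>The language has no negative coefficients. Since \<open>nat\<close> cuts off at 0, the
  sign \<sigma> selects the positive or the negated negative coefficients, and \<open>effect\<close>
  puts the latter on the other side of the equation.\<close>

definition linear_part ::
    "nat \<Rightarrow> 'n edge list \<Rightarrow> nat \<Rightarrow> 'n \<Rightarrow> int list list \<Rightarrow> int \<Rightarrow> nat \<Rightarrow> pterm" where
  "linear_part d es K s N \<sigma> r = PAdd
     (psum (\<lambda>j. scaled (2 * d + 2 * length es) K (nat (\<sigma> * fetch 0 (fetch [] N r) j)) j) [0..<d])
     (psum (\<lambda>i. scaled (2 * d + 2 * length es) K (nat (\<sigma> * fetch 0 (edge_weight s es i) r))
        (2 * d + i)) [0..<length es])"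

definition effect :: "nat \<Rightarrow> 'n edge list \<Rightarrow> nat \<Rightarrow> 'n \<Rightarrow> int list list \<Rightarrow> pform" where
  "effect d es K s N = pconj (\<lambda>r. PEq
     (PAdd (PVar (d + r)) (linear_part d es K s N (- 1) r)) (linear_part d es K s N 1 r)) [0..<d]"

text \<open>Only balance and effect depend on the target, so the disjunction is confined to them;
  all disjuncts share the counts, ranks and doubled variables, and the quantifiers can stand in
  front.\<close>

definition walk_matrix ::
    "nat \<Rightarrow> 'n edge list \<Rightarrow> nat \<Rightarrow> 'n \<Rightarrow> ('n \<times> int list list) list \<Rightarrow> pform" where
  "walk_matrix d es K s tNs =
     PAnd (doubling (2 * d + 2 * length es) K)
     (PAnd (nonneg (2 * d) (2 * d + 2 * length es))
     (PAnd (ranked d es s)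
       (pdisj (\<lambda>tN. PAnd (conserved d es s (fst tN)) (effect d es K s (snd tN))) tNs)))"

definition walk_formula ::
    "nat \<Rightarrow> 'n edge list \<Rightarrow> nat \<Rightarrow> 'n \<Rightarrow> ('n \<times> int list list) list \<Rightarrow> pform" where
  "walk_formula d es K s tNs = foldr PEx [2 * d..<(K + 1) * (2 * d + 2 * length es)]
     (walk_matrix d es K s tNs)"

definition affine_value ::
    "nat \<Rightarrow> 'n edge list \<Rightarrow> 'n \<Rightarrow> int list list \<Rightarrow> (nat \<Rightarrow> int) \<Rightarrow> (nat \<Rightarrow> int) \<Rightarrow> nat \<Rightarrow> int" where
  "affine_value d es s N e x r =
     (\<Sum>j<d. fetch 0 (fetch [] N r) j * e j)
     + (\<Sum>i<length es. fetch 0 (edge_weight s es i) r * x i)"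

definition coeffs_bounded ::
    "nat \<Rightarrow> 'n edge list \<Rightarrow> nat \<Rightarrow> 'n \<Rightarrow> int list list \<Rightarrow> bool" where
  "coeffs_bounded d es K s N \<longleftrightarrow>
     (\<forall>r<d. (\<forall>j<d. \<bar>fetch 0 (fetch [] N r) j\<bar> < 2 ^ K) \<and>
            (\<forall>i<length es. \<bar>fetch 0 (edge_weight s es i) r\<bar> < 2 ^ K))"

lemma sum_list_upt: "(\<Sum>x\<leftarrow>[0..<n]. f x) = (\<Sum>x<n. f x)"
  by (simp add: sum_list_sum_nth atLeast0LessThan)

lemma teval_linear_part:
  assumes "holds e (doubling (2 * d + 2 * length es) K)" "coeffs_bounded d es K s N"
    and "r < d" "\<sigma> \<in> {1, -1}"
  shows "teval e (linear_part d es K s N \<sigma> r) =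
    (\<Sum>j<d. int (nat (\<sigma> * fetch 0 (fetch [] N r) j)) * e j)
    + (\<Sum>i<length es. int (nat (\<sigma> * fetch 0 (edge_weight s es i) r)) * e (2 * d + i))"
proof -
  have *: "teval e (scaled (2 * d + 2 * length es) K (nat (\<sigma> * c)) y) = int (nat (\<sigma> * c)) * e y"
    if "\<bar>c\<bar> < 2 ^ K" "y < 2 * d + 2 * length es" for c :: int and y
  proof (rule teval_scaled[OF assms(1) that(2)])
    have "\<sigma> * c < 2 ^ K"
      using that assms(4) by auto
    then have "nat (\<sigma> * c) < nat (2 ^ K)"
      by (subst nat_mono_iff) simp_all
    then show "nat (\<sigma> * c) < 2 ^ K"
      by (simp only: nat_power_eq nat_numeral zero_le_numeral)
  qed
  show ?thesis
    using assms(2,3) unfolding linear_part_def coeffs_bounded_def teval.simps teval_psum sum_list_upt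
    by (intro arg_cong2[of _ _ _ _ "(+)"] sum.cong refl *) auto
qed

lemma holds_effect:
  assumes "holds e (doubling (2 * d + 2 * length es) K)" "coeffs_bounded d es K s N"
  shows "holds e (effect d es K s N) \<longleftrightarrow>
    (\<forall>r<d. e (d + r) = affine_value d es s N e (\<lambda>i. e (2 * d + i)) r)"
proof -
  \<comment> \<open>Positive part minus negative part gives back the integer coefficient.\<close>
  have pos_neg: "(\<Sum>j<n. int (nat (1 * c j)) * f j) - (\<Sum>j<n. int (nat (- 1 * c j)) * f j)
      = (\<Sum>j<n. c j * f j)" for c f :: "nat \<Rightarrow> int" and n
    by (subst sum_subtractf[symmetric], rule sum.cong) (auto simp: left_diff_distrib[symmetric])
  have "e (d + r) + teval e (linear_part d es K s N (- 1) r) = teval e (linear_part d es K s N 1 r)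
      \<longleftrightarrow> e (d + r) = affine_value d es s N e (\<lambda>i. e (2 * d + i)) r" if "r < d" for r
    using teval_linear_part[OF assms that, of 1] teval_linear_part[OF assms that, of "- 1"]
      pos_neg[of "fetch 0 (fetch [] N r)" e d]
      pos_neg[of "\<lambda>i. fetch 0 (edge_weight s es i) r" "\<lambda>i. e (2 * d + i)" "length es"]
    unfolding affine_value_def by (intro iffI) (simp_all del: int_nat_eq)
  then show ?thesis
    by (auto simp: effect_def)
qed

lemma holds_conserved:
  assumes "\<And>i. i < length es \<Longrightarrow> e (2 * d + i) = int (x i)"
  shows "holds e (conserved d es s t) \<longleftrightarrow>
    flow {..<length es} (edge_src s es) (edge_tgt s es) x s t"
proof -
  let ?I = "{..<length es}"
  have through: "(\<Sum>i<length es. teval e (if end i = n then PVar (2 * d + i) else PZero))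
      = int (through ?I end x n)" for "end" and n :: 'a
    unfolding through_def of_nat_sum by (rule sum.cong) (auto simp: assms)
  let ?P = "\<lambda>n. through ?I (edge_src s es) x n + of_bool (n = t)
      = through ?I (edge_tgt s es) x n + of_bool (n = s)"
  let ?nodes = "insert s (insert t (fst ` set es \<union> (\<lambda>x. snd (snd x)) ` set es))"
  have "?P n" if "n \<notin> ?nodes" for n
  proof -
    have "edge_src s es i \<noteq> n" "edge_tgt s es i \<noteq> n" if "i < length es" for i
      using that \<open>n \<notin> ?nodes\<close> nth_mem[OF that] unfolding edge_src_def edge_tgt_def fetch_def by auto
    then show ?thesis
      using that by (simp add: through_def)
  qed
  moreover have "holds e (conserved d es s t) \<longleftrightarrow> (\<forall>n\<in>?nodes. ?P n)"
  proof -
    have one: "teval e (if b then POne else PZero) = int (of_bool b)" for b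
      by simp
    show ?thesis
      unfolding conserved_def holds_pconj holds.simps teval.simps teval_psum sum_list_upt through one
        of_nat_add[symmetric] of_nat_eq_iff
      by auto
  qed
  ultimately show ?thesis
    unfolding flow_def by blast
qed

lemma holds_ranked:
  assumes "\<And>i. i < length es \<Longrightarrow> e (2 * d + i) = int (x i)"
    and "\<And>i. i < length es \<Longrightarrow> e (2 * d + length es + i) = int (z i)"
  shows "holds e (ranked d es s) \<longleftrightarrow> (\<forall>i<length es. 0 < x i \<longrightarrow> edge_src s es i = s \<or>
    (\<exists>j<length es. edge_tgt s es j = edge_src s es i \<and> 0 < x j \<and> z j < z i))"
proof -
  have inner: "holds e (pdisj (\<lambda>j. if edge_tgt s es j = edge_src s es i
             then PAnd (PLess PZero (PVar (2 * d + j)))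
                    (PLess (PVar (2 * d + length es + j)) (PVar (2 * d + length es + i)))
             else PLess PZero PZero) [0..<length es]) \<longleftrightarrow>
    (\<exists>j\<in>{..<length es}. edge_tgt s es j = edge_src s es i \<and> 0 < x j \<and> z j < z i)"
    if "i < length es" for i
    unfolding holds_pdisj set_upt atLeast0LessThan
    by (rule bex_cong[OF refl]) (simp add: assms that)
  have "holds e (ranked d es s) \<longleftrightarrow> (\<forall>i\<in>{..<length es}. 0 < x i \<longrightarrow> edge_src s es i = s \<or>
    (\<exists>j\<in>{..<length es}. edge_tgt s es j = edge_src s es i \<and> 0 < x j \<and> z j < z i))"
    unfolding ranked_def holds_pconj set_upt atLeast0LessThan
    by (rule ball_cong[OF refl]) (auto simp: inner assms simp del: holds_pdisj)
  then show ?thesis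
    by auto
qed

lemma walk_matrix_imp_walk:
  assumes holds: "holds e (walk_matrix d es K s tNs)"
    and bounded: "\<And>t N. (t, N) \<in> set tNs \<Longrightarrow> coeffs_bounded d es K s N"
  shows "\<exists>(t, N)\<in>set tNs. \<exists>is. walk (edge_src s es) (edge_tgt s es) s is t \<and> set is \<subseteq> {..<length es}
    \<and> (\<forall>r<d. e (d + r) = affine_value d es s N e (\<lambda>i. int (count_list is i)) r)"
proof -
  let ?I = "{..<length es}"
  obtain t N where tN: "(t, N) \<in> set tNs" "holds e (conserved d es s t)" "holds e (effect d es K s N)"
    and dbl: "holds e (doubling (2 * d + 2 * length es) K)"
    and nn: "holds e (nonneg (2 * d) (2 * d + 2 * length es))" and rk: "holds e (ranked d es s)"
    using holds by (auto simp: walk_matrix_def)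
  define x where "x i = nat (e (2 * d + i))" for i
  define z where "z i = nat (e (2 * d + length es + i))" for i
  have nn': "0 \<le> e j" if "2 * d \<le> j" "j < 2 * d + 2 * length es" for j
    using nn that by (auto simp: nonneg_def not_less)
  have x: "e (2 * d + i) = int (x i)" and z: "e (2 * d + length es + i) = int (z i)"
    if "i < length es" for i
    using nn'[of "2 * d + i"] nn'[of "2 * d + length es + i"] that by (auto simp: x_def z_def)
  have rank: "\<forall>i<length es. 0 < x i \<longrightarrow> edge_src s es i = s \<or>
    (\<exists>j<length es. edge_tgt s es j = edge_src s es i \<and> 0 < x j \<and> z j < z i)"
    using rk by (subst (asm) holds_ranked[where x = x and z = z]) (simp_all add: x z)
  have "flow ?I (edge_src s es) (edge_tgt s es) x s t"
    using tN(2) by (subst (asm) holds_conserved[where x = x]) (simp_all add: x)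
  then obtain "is" where "is": "walk (edge_src s es) (edge_tgt s es) s is t" "set is \<subseteq> ?I"
    "\<forall>i\<in>?I. count_list is i = x i"
    using flow_rank_imp_walk[of ?I "edge_src s es" "edge_tgt s es" x s t z] rank by auto
  have "affine_value d es s N e (\<lambda>i. e (2 * d + i)) r
      = affine_value d es s N e (\<lambda>i. int (count_list is i)) r" for r
    unfolding affine_value_def using "is"(3) x by (auto intro!: sum.cong)
  then show ?thesis
    using tN "is" holds_effect[OF dbl bounded[OF tN(1)]] by auto
qed

lemma walk_imp_walk_matrix:
  assumes tN: "(t, N) \<in> set tNs" and bounded: "coeffs_bounded d es K s N"
    and "is": "walk (edge_src s es) (edge_tgt s es) s is t" "set is \<subseteq> {..<length es}"
    and val: "\<And>r. r < d \<Longrightarrow> e (d + r) = affine_value d es s N e (\<lambda>i. int (count_list is i)) r"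
  shows "\<exists>e'. (\<forall>i. i \<notin> {2 * d..<(K + 1) * (2 * d + 2 * length es)} \<longrightarrow> e' i = e i) \<and>
    holds e' (walk_matrix d es K s tNs)"
proof -
  let ?I = "{..<length es}" and ?B = "2 * d + 2 * length es"
  obtain z :: "nat \<Rightarrow> nat" where z: "\<And>i. i \<in> set is \<Longrightarrow> edge_src s es i = s
      \<or> (\<exists>j\<in>set is. edge_tgt s es j = edge_src s es i \<and> z j < z i)"
    using walk_imp_rank[OF "is"(1)] by blast
  \<comment> \<open>The base block: the given values, the counts of the walk and the ranks. Next,
    \<open>e'\<close> extends it to all blocks, block number \<open>i div B\<close> holding the base
    values times the corresponding power of two.\<close>
  define g where "g i = (if i < 2 * d then e i
    else if i < 2 * d + length es then int (count_list is (i - 2 * d))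
    else int (z (i - 2 * d - length es)))" for i
  define e' where "e' i = (if i < (K + 1) * ?B then 2 ^ (i div ?B) * g (i mod ?B) else e i)" for i
  have low: "e' i = g i" if "i < ?B" for i
  proof -
    have "i < (K + 1) * ?B"
      using that by (simp add: add.commute trans_less_add1)
    then show ?thesis
      using that by (simp add: e'_def)
  qed
  have dbl: "holds e' (doubling ?B K)"
  proof -
    have "e' (j + ?B) = e' j + e' j" if "j < K * ?B" for j
    proof -
      \<comment> \<open>An empty block occurs only in dimension 0 without edges, and then there is
        no such \<open>j\<close>; otherwise division by the block length is meaningful.\<close>
      have "0 < ?B"
        using that by (cases "?B = 0") auto
      then show ?thesis
        using that by (simp add: e'_def trans_less_add1)
    qed
    then show ?thesis
      unfolding doubling_def by simp
  qed
  have x: "e' (2 * d + i) = int (count_list is i)" if "i < length es" for i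
    using that by (simp add: low g_def)
  have zs: "e' (2 * d + length es + i) = int (z i)" if "i < length es" for i
    using that by (simp add: low g_def)
  have fix_low: "e' i = e i" if "i < 2 * d" for i
    using that by (simp add: low g_def)
  have "holds e' (nonneg (2 * d) ?B)"
    by (auto simp: nonneg_def low g_def)
  moreover have "holds e' (conserved d es s t)"
    by (subst holds_conserved[where x = "count_list is"]) (simp_all add: x flow_walk[OF _ "is"])
  moreover have "holds e' (ranked d es s)"
  proof (subst holds_ranked[where x = "count_list is" and z = z], simp add: x, simp add: zs, intro allI impI)
    fix i assume "i < length es" "0 < count_list is i"
    then have "i \<in> set is"
      using count_list_0_iff[of "is" i] by auto
    then show "edge_src s es i = s \<or> (\<exists>j<length es. edge_tgt s es j = edge_src s es i \<and>
        0 < count_list is j \<and> z j < z i)"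
      using z[of i] "is"(2) count_list_0_iff[of "is"] by (auto simp: subset_iff)
  qed
  moreover have "holds e' (effect d es K s N)"
    unfolding holds_effect[OF dbl bounded] using val x
    by (simp add: fix_low affine_value_def)
  ultimately have "holds e' (walk_matrix d es K s tNs)"
    using dbl tN unfolding walk_matrix_def by (auto intro!: bexI[of _ "(t, N)"])
  moreover have "e' i = e i" if "i \<notin> {2 * d..<(K + 1) * ?B}" for i
    using that fix_low[of i] by (cases "i < 2 * d") (simp_all add: e'_def)
  ultimately show ?thesis by blast
qed

theorem holds_walk_formula:
  assumes "\<And>t N. (t, N) \<in> set tNs \<Longrightarrow> coeffs_bounded d es K s N"
  shows "holds e (walk_formula d es K s tNs) \<longleftrightarrow>
    (\<exists>(t, N)\<in>set tNs. \<exists>is. walk (edge_src s es) (edge_tgt s es) s is t \<and> set is \<subseteq> {..<length es}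
      \<and> (\<forall>r<d. e (d + r) = affine_value d es s N e (\<lambda>i. int (count_list is i)) r))"
    (is "?L \<longleftrightarrow> ?R")
proof
  assume ?L
  then obtain e' where e': "\<And>i. i \<notin> {2 * d..<(K + 1) * (2 * d + 2 * length es)} \<Longrightarrow> e' i = e i"
    "holds e' (walk_matrix d es K s tNs)"
    by (auto simp: walk_formula_def holds_foldr_PEx)
  have low: "e' i = e i" if "i < 2 * d" for i
    using e'(1)[of i] that by auto
  obtain t N "is" where *: "(t, N) \<in> set tNs" "walk (edge_src s es) (edge_tgt s es) s is t"
    "set is \<subseteq> {..<length es}"
    "\<And>r. r < d \<Longrightarrow> e' (d + r) = affine_value d es s N e' (\<lambda>i. int (count_list is i)) r"
    using walk_matrix_imp_walk[OF e'(2)] assms by blast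
  have "e (d + r) = affine_value d es s N e (\<lambda>i. int (count_list is i)) r" if "r < d" for r
    using *(4)[OF that] that by (simp add: low affine_value_def)
  then show ?R
    using * by blast
next
  assume ?R
  then obtain t N "is" where *: "(t, N) \<in> set tNs" "walk (edge_src s es) (edge_tgt s es) s is t"
    "set is \<subseteq> {..<length es}"
    "\<And>r. r < d \<Longrightarrow> e (d + r) = affine_value d es s N e (\<lambda>i. int (count_list is i)) r"
    by blast
  show ?L
    using walk_imp_walk_matrix[of t N tNs d es K s "is" e] assms *
    unfolding walk_formula_def holds_foldr_PEx set_upt by blast
qed

subsection \<open>Shape and size of the formula\<close>

lemma existential_walk_formula: "existential (walk_formula d es K s tNs)"
proof -
  have "quantifier_free (walk_matrix d es K s tNs)"
    by (auto simp: walk_matrix_def doubling_def nonneg_def ranked_def conserved_def effect_def)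
  then show ?thesis
    unfolding existential_def walk_formula_def by blast
qed

lemma variable_index_less: "y < B \<Longrightarrow> k \<le> K \<Longrightarrow> y + k * B < (K + 1) * (B :: nat)"
  using mult_right_mono[of k K B] by (simp add: add_less_le_mono)

lemma tvars_scaled: "y < B \<Longrightarrow> tvars (scaled B K n y) \<subseteq> {..<(K + 1) * B}"
  using variable_index_less[of y B _ K] by (auto simp: scaled_def split: if_splits)

lemma free_vars_walk_formula: "free_vars (walk_formula d es K s tNs) \<subseteq> {..<2 * d}"
proof -
  let ?B = "2 * d + 2 * length es"
  let ?X = "{..<(K + 1) * ?B}"
  have low: "y \<in> ?X" if "y < ?B" for y
    using variable_index_less[OF that, of 0 K] by simp
  have "free_vars (doubling ?B K) \<subseteq> ?X"
    by (auto simp: doubling_def)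
  moreover have "free_vars (nonneg (2 * d) ?B) \<subseteq> ?X"
    using low by (auto simp: nonneg_def)
  moreover have "free_vars (ranked d es s) \<subseteq> ?X"
    unfolding ranked_def by (auto split: if_splits intro!: low[unfolded lessThan_iff])
  moreover have "free_vars (conserved d es s t) \<subseteq> ?X" for t
    unfolding conserved_def by (auto split: if_splits intro!: low[unfolded lessThan_iff])
  moreover have "tvars (linear_part d es K s N \<sigma> r) \<subseteq> ?X" for N \<sigma> r
    unfolding linear_part_def tvars.simps tvars_psum
    by (intro Un_least UN_least tvars_scaled) auto
  then have "free_vars (effect d es K s N) \<subseteq> ?X" for N
    using low by (fastforce simp: effect_def)
  ultimately have "free_vars (walk_matrix d es K s tNs) \<subseteq> ?X"
    unfolding walk_matrix_def free_vars.simps free_vars_pdisj by blast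
  then show ?thesis
    unfolding walk_formula_def free_vars_foldr_PEx by auto
qed

text \<open>Bounds of the shape constant times power of \<open>A\<close> pass through sums. The rule
  \<open>3 + l * (c + 1)\<close>, shared with conjunctions and disjunctions, allows 3 for the
  closing symbol or atom and 1 for the connective at each entry; it produces most of the numerals
  used below.\<close>

lemma tsize_psum:
  assumes "\<And>x. x \<in> set xs \<Longrightarrow> tsize (f x) \<le> c * A ^ k" "length xs \<le> l * A ^ m" "1 \<le> A"
    and "3 + l * (c + 1) \<le> c'" "m + k = n"
  shows "tsize (psum f xs) \<le> c' * A ^ n"
proof -
  have "tsize (psum f xs) \<le> 3 + length xs * (c * A ^ k + 1)"
    using assms(1) by (induction xs) (fastforce simp: psum_def)+
  also have "\<dots> \<le> 3 * A ^ (m + k) + (l * A ^ m) * ((c + 1) * A ^ k)"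
    using assms by (intro add_mono mult_mono) (auto simp: add_mono)
  also have "\<dots> = (3 + l * (c + 1)) * A ^ n"
    using assms(5) by (auto simp: algebra_simps power_add)
  also have "\<dots> \<le> c' * A ^ n"
    using assms(4) by (rule mult_right_mono) simp
  finally show ?thesis .
qed

lemma fsize_pconj_pdisj:
  assumes "\<And>x. x \<in> set xs \<Longrightarrow> fsize (f x) \<le> c * A ^ k" "length xs \<le> l * A ^ m" "1 \<le> A"
    and "3 + l * (c + 1) \<le> c'" "m + k = n"
  shows "fsize (pconj f xs) \<le> c' * A ^ n" "fsize (pdisj f xs) \<le> c' * A ^ n"
proof -
  have "3 + length xs * (c * A ^ k + 1) \<le> 3 * A ^ (m + k) + (l * A ^ m) * ((c + 1) * A ^ k)"
    using assms by (intro add_mono mult_mono) (auto simp: add_mono)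
  also have "\<dots> = (3 + l * (c + 1)) * A ^ n"
    using assms(5) by (auto simp: algebra_simps power_add)
  also have "\<dots> \<le> c' * A ^ n"
    using assms(4) by (rule mult_right_mono) simp
  finally have *: "3 + length xs * (c * A ^ k + 1) \<le> c' * A ^ n" .
  have "fsize (pconj f xs) \<le> 3 + length xs * (c * A ^ k + 1)"
    using assms(1) by (induction xs) (fastforce simp: pconj_def)+
  then show "fsize (pconj f xs) \<le> c' * A ^ n"
    using * by linarith
  have "fsize (pdisj f xs) \<le> 3 + length xs * (c * A ^ k + 1)"
    using assms(1) by (induction xs) (fastforce simp: pdisj_def)+
  then show "fsize (pdisj f xs) \<le> c' * A ^ n"
    using * by linarith
qed

lemma fsize_foldr_PEx:
  assumes "\<And>z. z \<in> set zs \<Longrightarrow> tsize (PVar z) \<le> c"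
  shows "fsize (foldr PEx zs f) \<le> length zs * (c + 1) + fsize f"
  using assms by (induction zs) (fastforce)+

text \<open>A variable has degree 2 in \<open>A\<close>, as the digits of an index are crudely
  bounded by the index. Each nesting then adds one degree: scaled variable 3, linear part 4, effect
  5, disjunction over targets 6. The other parts and the quantifier prefix have degree at most
  4.\<close>

lemma fsize_walk_formula:
  assumes "1 \<le> A" "d \<le> A" "length es \<le> A" "K \<le> A" "length tNs \<le> A"
  shows "fsize (walk_formula d es K s tNs) \<le> 500 * A ^ 6"
proof -
  let ?B = "2 * d + 2 * length es"
  have B: "?B \<le> 4 * A"
    using assms by simp
  have KB: "(K + 1) * ?B \<le> 8 * A ^ 2"
    using mult_mono[of "K + 1" "2 * A" ?B "4 * A"] assms by (simp add: power2_eq_square)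
  have A: "1 \<le> A ^ 2" "A ^ 2 \<le> A ^ 3" "A ^ 3 \<le> A ^ 4" "A ^ 4 \<le> A ^ 5" "A ^ 5 \<le> A ^ 6"
    using assms(1) by (auto intro: power_increasing)
  have var: "tsize (PVar i) \<le> 8 * A ^ 2" if "i < (K + 1) * ?B" for i
  proof -
    have "floorlog 2 i \<le> i"
      by (simp add: floorlog_le_iff)
    then show ?thesis
      using that KB by simp
  qed
  have power_pos: "Suc 0 \<le> A ^ n" for n
    using assms(1) by simp
  have low: "tsize (PVar i) \<le> 8 * A ^ 2" if "i < ?B" for i
    using var[of i] variable_index_less[OF that, of 0 K] by simp
  have low': "tsize (PVar (2 * d + i)) \<le> 8 * A ^ 2" "tsize (PVar (2 * d + length es + i)) \<le> 8 * A ^ 2"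
    if "i < length es" for i
    using that low by simp_all
  have scaled: "tsize (scaled ?B K n y) \<le> 12 * A ^ 3" if "y < ?B" for n y
    unfolding scaled_def
  proof (rule tsize_psum[where c = 8 and k = 2 and l = 1 and m = 1])
    fix k assume "k \<in> set [0..<K]"
    then show "tsize (if even (n div 2 ^ k) then PZero else PVar (y + k * ?B)) \<le> 8 * A ^ 2"
      using var[OF variable_index_less[OF that, of k K]] power_pos[of 2]
      by (cases "even (n div 2 ^ k)") (simp_all del: tsize.simps(1))
  qed (use assms in simp_all)
  have linear: "tsize (linear_part d es K s N \<sigma> r) \<le> 33 * A ^ 4" for N \<sigma> r
  proof -
    have "tsize (psum (\<lambda>j. scaled ?B K (f j) (g j)) [0..<n]) \<le> 16 * A ^ 4"
      if "n \<le> A" "\<And>j. j < n \<Longrightarrow> g j < ?B" for f g n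
      by (rule tsize_psum[where c = 12 and k = 3 and l = 1 and m = 1])
         (use assms scaled that in simp_all)
    from this[of d "\<lambda>j. j" "\<lambda>j. nat (\<sigma> * fetch 0 (fetch [] N r) j)"]
      this[of "length es" "\<lambda>i. 2 * d + i" "\<lambda>i. nat (\<sigma> * fetch 0 (edge_weight s es i) r)"]
    show ?thesis
      using assms A unfolding linear_part_def tsize.simps(4) by linarith
  qed
  have effect: "fsize (effect d es K s N) \<le> 80 * A ^ 5" for N
    unfolding effect_def
  proof (rule fsize_pconj_pdisj[where c = 76 and k = 4 and l = 1 and m = 1])
    fix r assume "r \<in> set [0..<d]"
    then have "tsize (PVar (d + r)) \<le> 8 * A ^ 2"
      by (intro low) simp
    then show "fsize (PEq (PAdd (PVar (d + r)) (linear_part d es K s N (- 1) r))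
        (linear_part d es K s N 1 r)) \<le> 76 * A ^ 4"
      using linear[of N "- 1" r] linear[of N 1 r] A unfolding fsize.simps tsize.simps(4) by linarith
  qed (use assms in simp_all)
  have conserved: "fsize (conserved d es s t) \<le> 123 * A ^ 4" for t
    unfolding conserved_def
  \<comment> \<open>The list of nodes has \<open>2 + 2 * length es\<close> entries, hence the factor
    4.\<close>
  proof (rule fsize_pconj_pdisj[where c = 29 and k = 3 and l = 4 and m = 1])
    fix n
    have "tsize (psum (\<lambda>i. if P i then PVar (2 * d + i) else PZero) [0..<length es]) \<le> 12 * A ^ 3"
      for P
    proof (rule tsize_psum[where c = 8 and k = 2 and l = 1 and m = 1])
      fix i assume "i \<in> set [0..<length es]"
      then show "tsize (if P i then PVar (2 * d + i) else PZero) \<le> 8 * A ^ 2"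
        using low'(1)[of i] power_pos[of 2] by (cases "P i") (simp_all del: tsize.simps(1))
    qed (use assms in simp_all)
    note psum = this[of "\<lambda>i. edge_src s es i = n"] this[of "\<lambda>i. edge_tgt s es i = n"]
    have one: "tsize (if b then POne else PZero) = 1" for b
      by simp
    show "fsize (PEq
     (PAdd (psum (\<lambda>i. if edge_src s es i = n then PVar (2 * d + i) else PZero) [0..<length es])
       (if n = t then POne else PZero))
     (PAdd (psum (\<lambda>i. if edge_tgt s es i = n then PVar (2 * d + i) else PZero) [0..<length es])
       (if n = s then POne else PZero))) \<le> 29 * A ^ 3"
      using psum A unfolding fsize.simps tsize.simps(4) one by linarith
  qed (use assms in simp_all)
  have ranked: "fsize (ranked d es s) \<le> 47 * A ^ 4"
    unfolding ranked_def
  proof (rule fsize_pconj_pdisj[where c = 43 and k = 3 and l = 1 and m = 1])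
    fix i assume "i \<in> set [0..<length es]"
    then have i: "i < length es"
      by simp
    have "fsize (pdisj (\<lambda>j. if edge_tgt s es j = edge_src s es i
             then PAnd (PLess PZero (PVar (2 * d + j)))
                    (PLess (PVar (2 * d + length es + j)) (PVar (2 * d + length es + i)))
             else PLess PZero PZero) [0..<length es]) \<le> 32 * A ^ 3"
    proof (rule fsize_pconj_pdisj(2)[where c = 28 and k = 2 and l = 1 and m = 1])
      fix j assume "j \<in> set [0..<length es]"
      then show "fsize (if edge_tgt s es j = edge_src s es i
             then PAnd (PLess PZero (PVar (2 * d + j)))
                    (PLess (PVar (2 * d + length es + j)) (PVar (2 * d + length es + i)))
             else PLess PZero PZero) \<le> 28 * A ^ 2"
        using low'[of j] low'[OF i] power_pos[of 2]
        by (cases "edge_tgt s es j = edge_src s es i") (simp_all del: tsize.simps(1))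
    qed (use assms in simp_all)
    then show "fsize (POr (PEq (PVar (2 * d + i)) PZero)
     (if edge_src s es i = s then PEq PZero PZero
      else pdisj (\<lambda>j. if edge_tgt s es j = edge_src s es i
             then PAnd (PLess PZero (PVar (2 * d + j)))
                    (PLess (PVar (2 * d + length es + j)) (PVar (2 * d + length es + i)))
             else PLess PZero PZero) [0..<length es])) \<le> 43 * A ^ 3"
      using low'(1)[OF i] A power_pos[of 2]
      by (cases "edge_src s es i = s") (simp_all del: tsize.simps(1))
  qed (use assms in simp_all)
  have nonneg: "fsize (nonneg (2 * d) ?B) \<le> 27 * A ^ 3"
    unfolding nonneg_def
  proof (rule fsize_pconj_pdisj[where c = 11 and k = 2 and l = 2 and m = 1])
    fix j assume "j \<in> set [2 * d..<?B]"
    then show "fsize (PNot (PLess (PVar j) PZero)) \<le> 11 * A ^ 2"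
      using low[of j] power_pos[of 2] by (simp del: tsize.simps(1))
  qed (use assms in simp_all)
  have doubling: "fsize (doubling ?B K) \<le> 111 * A ^ 4"
    unfolding doubling_def
  proof (rule fsize_pconj_pdisj[where c = 26 and k = 2 and l = 4 and m = 2])
    fix j assume "j \<in> set [0..<K * ?B]"
    then have "j < K * ?B"
      by simp
    then show "fsize (PEq (PVar (j + ?B)) (PAdd (PVar j) (PVar j))) \<le> 26 * A ^ 2"
      using var[of j] var[of "j + ?B"] power_pos[of 2] by (simp del: tsize.simps(1))
  next
    show "length [0..<K * ?B] \<le> 4 * A ^ 2"
      using mult_mono[of K A ?B "4 * A"] assms by (simp add: power2_eq_square)
  qed (use assms in simp_all)
  have "fsize (pdisj (\<lambda>tN. PAnd (conserved d es s (fst tN)) (effect d es K s (snd tN))) tNs)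
      \<le> 208 * A ^ 6"
  proof (rule fsize_pconj_pdisj[where c = 204 and k = 5 and l = 1 and m = 1])
    show "fsize (PAnd (conserved d es s (fst tN)) (effect d es K s (snd tN))) \<le> 204 * A ^ 5" for tN
      using conserved[of "fst tN"] effect[of "snd tN"] A unfolding fsize.simps by linarith
  qed (use assms in simp_all)
  then have matrix: "fsize (walk_matrix d es K s tNs) \<le> 400 * A ^ 6"
    using doubling nonneg ranked A unfolding walk_matrix_def fsize.simps by linarith
  have "fsize (walk_formula d es K s tNs)
      \<le> length [2 * d..<(K + 1) * ?B] * (8 * A ^ 2 + 1) + fsize (walk_matrix d es K s tNs)"
    unfolding walk_formula_def by (rule fsize_foldr_PEx) (use var in auto)
  also have "\<dots> \<le> (8 * A ^ 2) * (9 * A ^ 2) + 400 * A ^ 6"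
    using KB A matrix by (intro add_mono mult_mono) simp_all
  also have "\<dots> = 72 * A ^ 4 + 400 * A ^ 6"
    by (simp add: power_add[symmetric])
  also have "\<dots> \<le> 500 * A ^ 6"
    using A by linarith
  finally show ?thesis .
qed

text \<open>The definitions are unfolded for projections of a single tuple, where the introduction
  rules apply under binders; arbitrary arguments follow by composition. The same device is used for
  the matrix operations.\<close>

lemma computable_walk_formula [computable_intros]:
  fixes es :: "'a :: coded \<Rightarrow> 'n :: bicoded edge list"
  assumes "computable d" "computable es" "computable K" "computable s" "computable tNs"
  shows "computable (\<lambda>x. walk_formula (d x) (es x) (K x) (s x) (tNs x))"
proof -
  have "computable (\<lambda>x :: nat \<times> 'n edge list \<times> nat \<times> 'n \<times> ('n \<times> int list list) list.
    walk_formula (fst x) (fst (snd x)) (fst (snd (snd x))) (fst (snd (snd (snd x))))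
      (snd (snd (snd (snd x)))))"
    unfolding walk_formula_def walk_matrix_def doubling_def nonneg_def ranked_def conserved_def
      effect_def linear_part_def scaled_def edge_src_def edge_tgt_def edge_weight_def
      pconj_def pdisj_def psum_def
    by (intro computable_intros)
  from computable_comp[OF this, of "\<lambda>x. (d x, es x, K x, s x, tNs x)"]
  show ?thesis
    by (simp add: computable_intros assms)
qed

section \<open>Matrices as lists of rows\<close>

definition one_rows :: "nat \<Rightarrow> int list list" where
  "one_rows d = map (\<lambda>i. map (\<lambda>j. if i = j then 1 else 0) [0..<d]) [0..<d]"

definition mult_rows :: "nat \<Rightarrow> int list list \<Rightarrow> int list list \<Rightarrow> int list list" where
  "mult_rows d A B = map (\<lambda>i. map (\<lambda>j. \<Sum>k\<leftarrow>[0..<d].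
     fetch 0 (fetch [] A i) k * fetch 0 (fetch [] B k) j) [0..<d]) [0..<d]"

definition apply_rows :: "nat \<Rightarrow> int list list \<Rightarrow> int list \<Rightarrow> int list" where
  "apply_rows d A b = map (\<lambda>i. \<Sum>k\<leftarrow>[0..<d]. fetch 0 (fetch [] A i) k * fetch 0 b k) [0..<d]"

lemma fetch_map_upt [simp]: "i < n \<Longrightarrow> fetch z (map f [0..<n]) i = f i"
  by (simp add: fetch_def)

lemma mat_to_list_carrier:
  "A \<in> carrier_mat d d \<Longrightarrow> mat_to_list A = map (\<lambda>i. map (\<lambda>j. A $$ (i, j)) [0..<d]) [0..<d]"
  by (auto simp: mat_to_list_def)

lemma list_of_vec_carrier: "v \<in> carrier_vec d \<Longrightarrow> list_of_vec v = map (\<lambda>i. v $ i) [0..<d]"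
  by (auto simp: list_eq_iff_nth_eq list_of_vec_index)

lemma one_rows: "one_rows d = mat_to_list (1\<^sub>m d)"
  by (subst mat_to_list_carrier[of _ d]) (auto simp: one_rows_def)

lemma mult_rows:
  assumes "A \<in> carrier_mat d d" "B \<in> carrier_mat d d"
  shows "mult_rows d (mat_to_list A) (mat_to_list B) = mat_to_list (A * B)"
  using assms
  by (subst mat_to_list_carrier[OF mult_carrier_mat[OF assms]])
     (auto simp: mult_rows_def mat_to_list_carrier scalar_prod_def sum_list_upt atLeast0LessThan
       intro!: sum.cong)

lemma apply_rows:
  assumes "A \<in> carrier_mat d d" "v \<in> carrier_vec d"
  shows "apply_rows d (mat_to_list A) (list_of_vec v) = list_of_vec (A *\<^sub>v v)"
  using assms
  by (subst list_of_vec_carrier[OF mult_mat_vec_carrier[OF assms]])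
     (auto simp: apply_rows_def mat_to_list_carrier list_of_vec_carrier scalar_prod_def sum_list_upt
       atLeast0LessThan intro!: sum.cong)

text \<open>The dimension has to be fixed: a matrix without rows forgets its number of columns.
  Equal nodes of the product graph thus carry equal matrices.\<close>

lemma inj_mat_to_list: "inj_on mat_to_list (carrier_mat d d)"
proof (rule inj_onI)
  fix A B :: "'a mat"
  assume AB: "A \<in> carrier_mat d d" "B \<in> carrier_mat d d" "mat_to_list A = mat_to_list B"
  show "A = B"
  proof (rule eq_matI)
    fix i j assume "i < dim_row B" "j < dim_col B"
    then have "i < d" "j < d"
      using AB by auto
    then have "mat_to_list A ! i ! j = A $$ (i, j)" "mat_to_list B ! i ! j = B $$ (i, j)"
      using AB by (simp_all add: mat_to_list_carrier[OF AB(1)] mat_to_list_carrier[OF AB(2)])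
    then show "A $$ (i, j) = B $$ (i, j)"
      using AB(3) by simp
  qed (use AB in auto)
qed

section \<open>Computing the formula from an instance code\<close>

type_synonym transition = "nat \<times> int list list \<times> int list \<times> nat"

definition products :: "nat \<Rightarrow> transition list \<Rightarrow> int list list list \<Rightarrow> int list list list" where
  "products d ts Ms = concat (map (\<lambda>N. map (\<lambda>t. mult_rows d N (fst (snd t))) ts) Ms)"

text \<open>These are the products of at most \<open>n\<close> generators. Insertion without
  repetition keeps the list no longer than the monoid, on which the size bound depends.\<close>

definition monoid_approx :: "nat \<Rightarrow> transition list \<Rightarrow> nat \<Rightarrow> int list list list" where
  "monoid_approx d ts n = rec_nat [one_rows d] (\<lambda>_ Ms. foldr List.insert (products d ts Ms) Ms) n"

text \<open>
  Edges are traversed against the direction of the run: at a node \<open>(q, N)\<close> the matrix \<open>N\<close> is the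
  product of the matrices of a run that starts in \<open>q\<close>, and taking a further transition
  \<open>(p, A, b, q)\<close> in front of that run adds \<open>N *\<^sub>v b\<close> to its effect.
\<close>

definition product_edges ::
    "nat \<Rightarrow> transition list \<Rightarrow> int list list list \<Rightarrow> (nat \<times> int list list) edge list" where
  "product_edges d ts Ms = concat (map (\<lambda>N. map (\<lambda>t.
     ((snd (snd (snd t)), N), apply_rows d N (fst (snd (snd t))), (fst t, mult_rows d N (fst (snd t)))))
     ts) Ms)"

text \<open>The same bound \<open>n\<close> serves for the generation of the monoid and for the bit length.\<close>

definition ready :: "nat \<Rightarrow> transition list \<Rightarrow> nat \<Rightarrow> bool" where
  "ready d ts n \<longleftrightarrow>
     (\<forall>P\<in>set (products d ts (monoid_approx d ts n)). P \<in> set (monoid_approx d ts n)) \<and>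
     (\<forall>N\<in>set (monoid_approx d ts n). \<forall>r\<in>set N. \<forall>c\<in>set r. nat \<bar>c\<bar> < 2 ^ n) \<and>
     (\<forall>x\<in>set (product_edges d ts (monoid_approx d ts n)). \<forall>c\<in>set (fst (snd x)). nat \<bar>c\<bar> < 2 ^ n)"

text \<open>The matrix occurs twice in each target: as part of the end node, and as the coefficients
  applied to the starting vector.\<close>

definition reach_formula :: "nat \<Rightarrow> transition list \<Rightarrow> nat \<Rightarrow> nat \<Rightarrow> nat \<Rightarrow> pform" where
  "reach_formula d ts p q n =
     walk_formula d (product_edges d ts (monoid_approx d ts n)) n (q, one_rows d)
       (map (\<lambda>N. ((p, N), N)) (monoid_approx d ts n))"

text \<open>Defaults and the totality of \<open>decode\<close> give malformed codes some value, so
  that parsing is a total computable function.\<close>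

definition parse :: "nat \<Rightarrow> nat \<times> transition list \<times> nat \<times> nat" where
  "parse w = (let l = decode w in (fetch 0 l 0,
     map (\<lambda>t. (fetch 0 t 0, decode (fetch 0 t 1), decode (fetch 0 t 2), fetch 0 t 3))
       (decode (fetch 0 l 2) :: nat list list),
     fetch 0 l 3, fetch 0 l 4))"

lemma computable_mult_rows [computable_intros]:
  assumes "computable d" "computable A" "computable B"
  shows "computable (\<lambda>x. mult_rows (d x) (A x) (B x))"
proof -
  have "computable (\<lambda>x. mult_rows (fst x) (fst (snd x)) (snd (snd x)))"
    unfolding mult_rows_def by (intro computable_intros)
  from computable_comp[OF this, of "\<lambda>x. (d x, A x, B x)"] show ?thesis
    by (simp add: computable_intros assms)
qed

lemma computable_apply_rows [computable_intros]:
  assumes "computable d" "computable A" "computable b"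
  shows "computable (\<lambda>x. apply_rows (d x) (A x) (b x))"
proof -
  have "computable (\<lambda>x. apply_rows (fst x) (fst (snd x)) (snd (snd x)))"
    unfolding apply_rows_def by (intro computable_intros)
  from computable_comp[OF this, of "\<lambda>x. (d x, A x, b x)"] show ?thesis
    by (simp add: computable_intros assms)
qed

lemma computable_one_rows [computable_intros]:
  assumes "computable d"
  shows "computable (\<lambda>x. one_rows (d x))"
  by (rule computable_comp[OF _ assms]) (unfold one_rows_def, intro computable_intros)

lemma computable_products [computable_intros]:
  assumes "computable d" "computable ts" "computable Ms"
  shows "computable (\<lambda>x. products (d x) (ts x) (Ms x))"
proof -
  have "computable (\<lambda>x. products (fst x) (fst (snd x)) (snd (snd x)))"
    unfolding products_def by (intro computable_intros)
  from computable_comp[OF this, of "\<lambda>x. (d x, ts x, Ms x)"] show ?thesis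
    by (simp add: computable_intros assms)
qed

lemma computable_product_edges [computable_intros]:
  assumes "computable d" "computable ts" "computable Ms"
  shows "computable (\<lambda>x. product_edges (d x) (ts x) (Ms x))"
proof -
  have "computable (\<lambda>x. product_edges (fst x) (fst (snd x)) (snd (snd x)))"
    unfolding product_edges_def by (intro computable_intros)
  from computable_comp[OF this, of "\<lambda>x. (d x, ts x, Ms x)"] show ?thesis
    by (simp add: computable_intros assms)
qed

lemma computable_monoid_approx [computable_intros]:
  assumes "computable d" "computable ts" "computable n"
  shows "computable (\<lambda>x. monoid_approx (d x) (ts x) (n x))"
proof -
  have "computable (\<lambda>x. monoid_approx (fst x) (fst (snd x)) (snd (snd x)))"
    unfolding monoid_approx_def by (intro computable_intros)
  from computable_comp[OF this, of "\<lambda>x. (d x, ts x, n x)"] show ?thesis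
    by (simp add: computable_intros assms)
qed

lemma computable_parse [computable_intros]:
  assumes "computable f"
  shows "computable (\<lambda>x. parse (f x))"
  by (rule computable_comp[OF _ assms]) (unfold parse_def Let_def, intro computable_intros)

text \<open>The formula is built for the least admissible bound, so exhibiting one admissible bound
  proves termination and limits the size at once.\<close>

lemma partial_recursive_formula:
  obtains F where "partial_recursive F"
    "\<And>w d ts p q n. parse w = (d, ts, p, q) \<Longrightarrow> ready d ts n \<Longrightarrow>
       F w = Some (fcode (reach_formula d ts p q (LEAST n. ready d ts n)))"
proof -
  let ?P = "\<lambda>w. ready (fst (parse w)) (fst (snd (parse w)))"
  let ?G = "\<lambda>w. reach_formula (fst (parse w)) (fst (snd (parse w))) (fst (snd (snd (parse w))))
    (snd (snd (snd (parse w))))"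
  have "computable (\<lambda>z. ?P (fst z) (snd z))"
    unfolding ready_def by (intro computable_intros)
  moreover have "computable (\<lambda>z. ?G (fst z) (snd z))"
    unfolding reach_formula_def by (intro computable_intros)
  ultimately obtain F where F: "partial_recursive F"
    "\<And>w n. ?P w n \<Longrightarrow> F (code w) = Some (code (?G w (LEAST n. ?P w n)))"
    using partial_recursive_search[of ?P ?G] by blast
  show ?thesis
  proof (rule that[OF F(1)])
    fix w d ts p q n assume "parse w = (d, ts, p, q)" "ready d ts n"
    then show "F w = Some (fcode (reach_formula d ts p q (LEAST n. ready d ts n)))"
      using F(2)[of w n] by (simp add: code_nat_def code_pform_def)
  qed
qed

text \<open>The codes of vectors, matrices and transitions are, after unfolding, the class codes of
  lists of integers, of rows and of naturals, so \<open>decode\<close> undoes them.\<close>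

lemma parse_instance_code:
  "parse (instance_code name d qs ts p q) =
     (d, map (\<lambda>(p, A, b, q). (name p, mat_to_list A, list_of_vec b, name q)) ts, name p, name q)"
proof -
  have nats: "list_encode xs = code xs" for xs :: "nat list"
    by (simp add: code_list_def code_nat_def map_idI)
  have natss: "list_encode (map list_encode xs) = code xs" for xs :: "nat list list"
    by (subst code_list_def) (rule arg_cong[of _ _ list_encode], simp add: nats)
  have "list_encode (map int_encode r) = code r" for r
    by (simp add: code_list_def code_int_def)
  then have mats: "mat_code A = code (mat_to_list A)" for A
    by (simp add: mat_code_def code_list_def[of "mat_to_list A"] cong: map_cong)
  have vecs: "vec_code b = code (list_of_vec b)" for b
    by (simp add: vec_code_def code_list_def code_int_def)
  define row where "row t = (case t of (p, A, b, q) \<Rightarrow>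
    [name p, mat_code A, vec_code b, name q])" for t :: "'a \<times> int mat \<times> int vec \<times> 'a"
  have "trans_code name = list_encode \<circ> row"
    by (auto simp: row_def fun_eq_iff)
  then have "map (trans_code name) ts = map list_encode (map row ts)"
    by simp
  then have ts: "list_encode (map (trans_code name) ts) = code (map row ts)"
    by (simp only: natss)
  show ?thesis
    unfolding parse_def instance_code_def ts
    unfolding nats
    by (auto simp: fetch_def row_def mats vecs)
qed

section \<open>Correctness\<close>

text \<open>Only the final state \<open>q\<close> is fixed, being the source of the backward walks;
  the initial state varies in the inductions.\<close>

locale zvass_instance =
  fixes V :: "'q avass" and name :: "'q \<Rightarrow> nat" and ts :: "('q \<times> int mat \<times> int vec \<times> 'q) list"
    and q :: 'q
  assumes affine: "affine_zvass V" and finite_monoid: "finite (avass_monoid V)"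
    and inj_name: "inj_on name (states V)"
    and distinct_ts: "distinct ts" and set_ts: "set ts = transitions V"
    and q: "q \<in> states V"
begin

abbreviation d where "d \<equiv> dimension V"
abbreviation M where "M \<equiv> avass_monoid V"

definition row_ts :: "transition list" where
  "row_ts = map (\<lambda>(p, A, b, q). (name p, mat_to_list A, list_of_vec b, name q)) ts"

lemma transition:
  assumes "(p, A, b, r) \<in> transitions V"
  shows "p \<in> states V" "A \<in> carrier_mat d d" "b \<in> carrier_vec d" "r \<in> states V" "A \<in> M"
proof -
  have "A \<in> trans_mats V"
    using assms unfolding trans_mats_def by blast
  then show "A \<in> M"
    by (rule avass_monoid.gen)
qed (use assms affine in \<open>auto simp: affine_zvass_def\<close>)

lemma monoid_carrier: "N \<in> M \<Longrightarrow> N \<in> carrier_mat d d"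
  by (induction rule: avass_monoid.induct) (auto simp: trans_mats_def dest: transition)

lemma set_products:
  assumes "set Ms \<subseteq> mat_to_list ` M"
  shows "set (products d row_ts Ms) =
    {mat_to_list (N * A) |N A. N \<in> M \<and> mat_to_list N \<in> set Ms \<and> A \<in> trans_mats V}"
proof -
  have "set (products d row_ts Ms) = (\<Union>L\<in>set Ms. (\<lambda>A. mult_rows d L (mat_to_list A)) ` trans_mats V)"
    unfolding products_def row_ts_def by (force simp: set_ts trans_mats_def)
  also have "\<dots> = (\<Union>N\<in>{N\<in>M. mat_to_list N \<in> set Ms}.
      (\<lambda>A. mult_rows d (mat_to_list N) (mat_to_list A)) ` trans_mats V)"
    using assms by fastforce
  also have "\<dots> = (\<Union>N\<in>{N\<in>M. mat_to_list N \<in> set Ms}. (\<lambda>A. mat_to_list (N * A)) ` trans_mats V)"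
    by (intro SUP_cong image_cong refl mult_rows monoid_carrier)
       (auto simp: trans_mats_def dest: transition)
  finally show ?thesis
    by blast
qed

section \<open>Stabilisation of the generated matrices\<close>

abbreviation Ms where "Ms n \<equiv> monoid_approx d row_ts n"

lemma set_foldr_insert: "set (foldr List.insert xs ys) = set xs \<union> set ys"
  by (induction xs) auto

lemma distinct_foldr_insert: "distinct ys \<Longrightarrow> distinct (foldr List.insert xs ys)"
  by (induction xs) auto

lemma Ms_0: "set (Ms 0) = {mat_to_list (1\<^sub>m d)}"
  by (simp add: monoid_approx_def one_rows)

lemma Ms_Suc: "set (Ms (Suc n)) = set (products d row_ts (Ms n)) \<union> set (Ms n)"
  by (simp add: monoid_approx_def set_foldr_insert)

lemma distinct_Ms: "distinct (Ms n)"
  by (induction n) (simp_all add: monoid_approx_def distinct_foldr_insert)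

lemma Ms_subset: "set (Ms n) \<subseteq> mat_to_list ` M"
proof (induction n)
  case 0
  then show ?case by (simp add: Ms_0 avass_monoid.one)
next
  case (Suc n)
  have "N * A \<in> M" if "N \<in> M" "A \<in> trans_mats V" for N A
    using avass_monoid.mult[OF that(1) avass_monoid.gen[OF that(2)]] .
  with Suc show ?case
    by (auto simp: Ms_Suc set_products)
qed

lemma one_in_Ms: "mat_to_list (1\<^sub>m d) \<in> set (Ms n)"
  by (induction n) (simp_all add: Ms_0 Ms_Suc)

definition stable where "stable n \<longleftrightarrow> set (products d row_ts (Ms n)) \<subseteq> set (Ms n)"

lemma stable_mono:
  assumes "stable m" "m \<le> n"
  shows "set (Ms n) = set (Ms m)" "stable n"
proof -
  have "set (Ms n) = set (Ms m) \<and> stable n"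
    using assms(2)
  proof (induction n rule: dec_induct)
    case base
    then show ?case using assms(1) by simp
  next
    case (step n)
    then have eq: "set (Ms (Suc n)) = set (Ms n)"
      by (auto simp: Ms_Suc stable_def)
    then have "set (products d row_ts (Ms (Suc n))) = set (products d row_ts (Ms n))"
      using Ms_subset by (simp add: set_products)
    then show ?case
      using eq step.IH unfolding stable_def by metis
  qed
  then show "set (Ms n) = set (Ms m)" "stable n" by auto
qed

lemma card_Ms_le: "card (set (Ms n)) \<le> card M"
  using card_mono[OF finite_imageI[OF finite_monoid] Ms_subset] card_image_le[OF finite_monoid]
    le_trans by blast

text \<open>Pigeonhole: starting from one matrix, every round before stabilisation adds another, so
  \<open>card M\<close> such rounds would give more matrices than the monoid has.\<close>

lemma stable_at_card: "stable (card M)"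
proof (rule ccontr)
  assume not: "\<not> stable (card M)"
  have "n \<le> Suc (card M) \<Longrightarrow> Suc n \<le> card (set (Ms n))" for n
  proof (induction n)
    case 0
    then show ?case by (simp add: Ms_0)
  next
    case (Suc n)
    then have "\<not> stable n"
      using stable_mono(2)[of n "card M"] not by auto
    then have "set (Ms n) \<subset> set (Ms (Suc n))"
      by (auto simp: Ms_Suc stable_def)
    then have "card (set (Ms n)) < card (set (Ms (Suc n)))"
      by (intro psubset_card_mono) auto
    then show ?case
      using Suc by simp
  qed
  from this[of "card M"] card_Ms_le[of "card M"] show False
    by simp
qed

text \<open>Stability only gives closure under right multiplication by generators. Generalising over
  the left factor \<open>N\<close> turns multiplication by \<open>A * B\<close> into two successive
  ones, and taking the identity for \<open>N\<close> yields the whole monoid.\<close>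

lemma stable_imp_Ms:
  assumes "stable n"
  shows "set (Ms n) = mat_to_list ` M"
proof -
  have "mat_to_list (N * B) \<in> set (Ms n)" if "B \<in> M" "N \<in> M" "mat_to_list N \<in> set (Ms n)" for B N
    using that
  proof (induction B arbitrary: N rule: avass_monoid.induct)
    case one
    then show ?case using right_mult_one_mat[OF monoid_carrier[OF one(1)]] by simp
  next
    case (gen A)
    then show ?case
      using assms unfolding stable_def set_products[OF Ms_subset] by blast
  next
    case (mult A B)
    have "N * (A * B) = N * A * B"
      using assoc_mult_mat[of N d d A d B d] mult monoid_carrier by simp
    then show ?case
      using mult.IH mult.prems mult.hyps avass_monoid.mult by metis
  qed
  from this[OF _ avass_monoid.one one_in_Ms] have "mat_to_list ` M \<subseteq> set (Ms n)"
    using left_mult_one_mat[OF monoid_carrier] by fastforce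
  with Ms_subset show ?thesis by blast
qed

lemma length_Ms: "length (Ms n) \<le> card M"
  using card_Ms_le[of n] distinct_card[OF distinct_Ms] by metis

abbreviation es where "es n \<equiv> product_edges d row_ts (Ms n)"

lemma length_es: "length (es n) \<le> card M * card (transitions V)"
proof -
  have "length (es n) = length (Ms n) * length ts"
    unfolding product_edges_def length_concat map_map comp_def length_map row_ts_def
    by (simp add: sum_list_triv)
  moreover have "length ts = card (transitions V)"
    using distinct_card[OF distinct_ts] set_ts by simp
  ultimately show ?thesis
    using length_Ms[of n] by simp
qed

lemma set_row_ts:
  "set row_ts = (\<lambda>(p, A, b, r). (name p, mat_to_list A, list_of_vec b, name r)) ` transitions V"
  by (simp add: row_ts_def set_ts)

lemma set_es:
  assumes "stable n"
  shows "set (es n) = (\<Union>N\<in>M. (\<lambda>(p, A, b, r). ((name r, mat_to_list N), list_of_vec (N *\<^sub>v b),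
    (name p, mat_to_list (N * A)))) ` transitions V)"
proof -
  have "set (es n) = (\<Union>N\<in>M. (\<lambda>(p, A, b, r). ((name r, mat_to_list N),
      apply_rows d (mat_to_list N) (list_of_vec b),
      (name p, mult_rows d (mat_to_list N) (mat_to_list A)))) ` transitions V)"
    unfolding product_edges_def
    by (simp add: stable_imp_Ms[OF assms] set_row_ts image_image case_prod_beta)
  also have "\<dots> = (\<Union>N\<in>M. (\<lambda>(p, A, b, r). ((name r, mat_to_list N), list_of_vec (N *\<^sub>v b),
    (name p, mat_to_list (N * A)))) ` transitions V)"
  proof (intro SUP_cong image_cong refl)
    fix N t assume N: "N \<in> M" and t: "t \<in> transitions V"
    obtain p A b r where "t = (p, A, b, r)"
      by (cases t)
    then show "(case t of (p, A, b, r) \<Rightarrow> ((name r, mat_to_list N),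
        apply_rows d (mat_to_list N) (list_of_vec b),
        (name p, mult_rows d (mat_to_list N) (mat_to_list A)))) =
      (case t of (p, A, b, r) \<Rightarrow> ((name r, mat_to_list N), list_of_vec (N *\<^sub>v b),
        (name p, mat_to_list (N * A))))"
      using t monoid_carrier[OF N] transition(2,3)[of p A b r] by (simp add: apply_rows mult_rows)
  qed
  finally show ?thesis .
qed

text \<open>
  The walks in the product graph from \<open>(q, 1)\<close> to \<open>(p, N)\<close> are the runs from \<open>p\<close> to \<open>q\<close>, read
  backwards, whose effect has the linear part \<open>N\<close>.
\<close>

abbreviation source where "source \<equiv> (name q, one_rows d)"
abbreviation walks where "walks n \<equiv> walk (edge_src source (es n)) (edge_tgt source (es n)) source"

definition weight :: "nat \<Rightarrow> nat list \<Rightarrow> int vec" where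
  "weight n is = vec d (\<lambda>r. \<Sum>i\<leftarrow>is. fetch 0 (edge_weight source (es n) i) r)"

lemma weight_carrier: "weight n is \<in> carrier_vec d"
  by (simp add: weight_def)

lemma weight_Nil: "weight n [] = 0\<^sub>v d"
  by (auto simp: weight_def)

lemma weight_snoc:
  assumes "edge_weight source (es n) i = list_of_vec b" "b \<in> carrier_vec d"
  shows "weight n (is @ [i]) = weight n is + b"
  using assms by (auto simp: weight_def fetch_def list_of_vec_index intro!: eq_vecI)

lemma edge_parts:
  assumes "i < length (es n)"
  shows "es n ! i = (edge_src source (es n) i, edge_weight source (es n) i, edge_tgt source (es n) i)"
  using assms by (simp add: edge_src_def edge_weight_def edge_tgt_def fetch_def)

text \<open>The identity behind the weights: composing the map with linear part \<open>N\<close> and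
  translation \<open>w\<close> with one earlier transition changes the linear part to
  \<open>N * A\<close> and the translation by the product of \<open>N\<close> and
  \<open>b\<close>.\<close>

lemma affine_snoc:
  assumes "N \<in> carrier_mat d d" "A \<in> carrier_mat d d" "b \<in> carrier_vec d" "u \<in> carrier_vec d"
    "w \<in> carrier_vec d"
  shows "N *\<^sub>v (A *\<^sub>v u + b) + w = (N * A) *\<^sub>v u + (w + N *\<^sub>v b)"
proof -
  have "N *\<^sub>v (A *\<^sub>v u + b) = (N * A) *\<^sub>v u + N *\<^sub>v b"
    using assms by (subst mult_add_distrib_mat_vec[of _ d d]) auto
  moreover have "(N * A) *\<^sub>v u \<in> carrier_vec d" "N *\<^sub>v b \<in> carrier_vec d"
    using assms by auto
  ultimately show ?thesis
    using assms by (simp add: assoc_add_vec[of _ d] comm_add_vec[of _ d])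
qed

text \<open>The claim covers all starting vectors because the last edge of the walk is the first
  transition of the run: the induction hypothesis is applied to the vector after that
  transition.\<close>

lemma walk_imp_reach:
  assumes "stable n" "walks n is t" "set is \<subseteq> {..<length (es n)}"
  shows "\<exists>N\<in>M. \<exists>r\<in>states V. t = (name r, mat_to_list N) \<and>
    (\<forall>u\<in>carrier_vec d. reach V (r, u) (q, N *\<^sub>v u + weight n is))"
  using assms(2,3)
proof (induction "is" arbitrary: t rule: rev_induct)
  case Nil
  then show ?case
    using q by (intro bexI[of _ "1\<^sub>m d"] bexI[of _ q])
      (auto simp: one_rows weight_Nil reach_def avass_monoid.one)
next
  case (snoc i "is")
  let ?s = "edge_src source (es n) i"
  have i: "i < length (es n)" and t: "t = edge_tgt source (es n) i" and walk: "walks n is ?s"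
    using snoc.prems by (auto simp: walk_append)
  obtain N r where N: "N \<in> M" "r \<in> states V" "?s = (name r, mat_to_list N)"
    and reach: "\<And>u. u \<in> carrier_vec d \<Longrightarrow> reach V (r, u) (q, N *\<^sub>v u + weight n is)"
    using snoc.IH[OF walk] snoc.prems by auto
  obtain N' p A b r' where N': "N' \<in> M" and tr: "(p, A, b, r') \<in> transitions V"
    and e: "es n ! i = ((name r', mat_to_list N'), list_of_vec (N' *\<^sub>v b), (name p, mat_to_list (N' * A)))"
    using nth_mem[OF i] unfolding set_es[OF assms(1)] by auto
  have "name r' = name r" "mat_to_list N' = mat_to_list N"
    using e N(3) edge_parts[OF i] by auto
  \<comment> \<open>The edge starts at the current node; injectivity of names and of row lists
    identifies its state and its matrix with those of the induction hypothesis.\<close>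
  then have eq: "r' = r" "N' = N"
    using inj_onD[OF inj_name, of r' r] inj_onD[OF inj_mat_to_list, of N' N d]
      transition(4)[OF tr] N N' monoid_carrier by auto
  note carriers = monoid_carrier[OF N(1)] transition(2,3)[OF tr]
  have "reach V (p, u) (q, (N * A) *\<^sub>v u + weight n (is @ [i]))" if u: "u \<in> carrier_vec d" for u
  proof -
    have "step V (p, A, b, r) (p, u) (r, A *\<^sub>v u + b)"
      using tr u unfolding step_def eq by blast
    moreover have "reach V (r, A *\<^sub>v u + b) (q, N *\<^sub>v (A *\<^sub>v u + b) + weight n is)"
      using carriers u by (intro reach) auto
    moreover have "N *\<^sub>v (A *\<^sub>v u + b) + weight n is = (N * A) *\<^sub>v u + weight n (is @ [i])"
      using e eq edge_parts[OF i] carriers u weight_snoc[of n i "N *\<^sub>v b" "is"]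
        affine_snoc[of N A b u "weight n is"] weight_carrier by simp
    ultimately show ?thesis
      using tr eq unfolding reach_def by (metis (no_types, lifting) converse_rtranclp_into_rtranclp)
  qed
  moreover have "t = (name p, mat_to_list (N * A))"
    using t e eq edge_parts[OF i] by simp
  moreover have "N * A \<in> M" "p \<in> states V"
    using avass_monoid.mult[OF N(1) transition(5)[OF tr]] transition(1)[OF tr] by auto
  ultimately show ?case by blast
qed

lemma reach_imp_walk:
  assumes "stable n" "reach V (p, u) (q, v)" "p \<in> states V" "u \<in> carrier_vec d"
  shows "\<exists>N\<in>M. \<exists>is. walks n is (name p, mat_to_list N) \<and> set is \<subseteq> {..<length (es n)} \<and>
    v = N *\<^sub>v u + weight n is"
proof -
  \<comment> \<open>The run grows at its front, the walk at its back. The dimension of the vector is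
    kept inside the claim, so that it is carried from one configuration to the next.\<close>
  have "snd c \<in> carrier_vec d \<longrightarrow> (\<exists>N\<in>M. \<exists>is. walks n is (name (fst c), mat_to_list N) \<and>
      set is \<subseteq> {..<length (es n)} \<and> v = N *\<^sub>v snd c + weight n is)"
    if "(\<lambda>c c'. \<exists>t\<in>transitions V. step V t c c')\<^sup>*\<^sup>* c (q, v)" for c
    using that
  proof (induction rule: converse_rtranclp_induct)
    case base
    have "walks n [] (name q, mat_to_list (1\<^sub>m d)) \<and> set [] \<subseteq> {..<length (es n)} \<and>
      v = 1\<^sub>m d *\<^sub>v v + weight n []" if "v \<in> carrier_vec d"
      using that by (simp add: one_rows weight_Nil)
    then show ?case
      using avass_monoid.one[of V] by (metis fst_conv snd_conv)
  next
    case (step c c')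
    show ?case
    proof
      assume "snd c \<in> carrier_vec d"
      then obtain p u r A b where tr: "(p, A, b, r) \<in> transitions V" and c: "c = (p, u)"
        "c' = (r, A *\<^sub>v u + b)" and u: "u \<in> carrier_vec d"
        using step.hyps(1) by (auto simp: step_def)
      have "snd c' \<in> carrier_vec d"
        using transition(2,3)[OF tr] u c by auto
      then obtain N "is" where N: "N \<in> M" "walks n is (name r, mat_to_list N)"
        "set is \<subseteq> {..<length (es n)}" "v = N *\<^sub>v (A *\<^sub>v u + b) + weight n is"
        using step.IH c by auto
      have "((name r, mat_to_list N), list_of_vec (N *\<^sub>v b), (name p, mat_to_list (N * A))) \<in> set (es n)"
        unfolding set_es[OF assms(1)] using N(1) tr by force
      then obtain i where i: "i < length (es n)"
        "es n ! i = ((name r, mat_to_list N), list_of_vec (N *\<^sub>v b), (name p, mat_to_list (N * A)))"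
        by (auto simp: in_set_conv_nth)
      note carriers = monoid_carrier[OF N(1)] transition(2,3)[OF tr]
      have "walks n (is @ [i]) (name p, mat_to_list (N * A))"
        using N(2) i edge_parts[OF i(1)] by (auto simp: walk_append)
      moreover have "v = (N * A) *\<^sub>v u + weight n (is @ [i])"
        using i edge_parts[OF i(1)] carriers u N(4) weight_snoc[of n i "N *\<^sub>v b" "is"]
          affine_snoc[of N A b u "weight n is"] weight_carrier by simp
      moreover have "N * A \<in> M"
        using avass_monoid.mult[OF N(1) transition(5)[OF tr]] .
      ultimately show "\<exists>N\<in>M. \<exists>is. walks n is (name (fst c), mat_to_list N) \<and>
        set is \<subseteq> {..<length (es n)} \<and> v = N *\<^sub>v snd c + weight n is"
        using c i(1) N(3) by (intro bexI[of _ "N * A"] exI[of _ "is @ [i]"]) auto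
    qed
  qed
  from this[of "(p, u)"] assms show ?thesis
    by (simp add: reach_def)
qed

lemma reach_iff_walk:
  assumes "stable n" "p \<in> states V" "u \<in> carrier_vec d"
  shows "reach V (p, u) (q, v) \<longleftrightarrow> (\<exists>N\<in>M. \<exists>is. walks n is (name p, mat_to_list N) \<and>
    set is \<subseteq> {..<length (es n)} \<and> v = N *\<^sub>v u + weight n is)"
proof
  assume "reach V (p, u) (q, v)"
  then show "\<exists>N\<in>M. \<exists>is. walks n is (name p, mat_to_list N) \<and>
    set is \<subseteq> {..<length (es n)} \<and> v = N *\<^sub>v u + weight n is"
    using reach_imp_walk assms by blast
next
  assume "\<exists>N\<in>M. \<exists>is. walks n is (name p, mat_to_list N) \<and>
    set is \<subseteq> {..<length (es n)} \<and> v = N *\<^sub>v u + weight n is"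
  then obtain N "is" where N: "N \<in> M" "walks n is (name p, mat_to_list N)"
    "set is \<subseteq> {..<length (es n)}" "v = N *\<^sub>v u + weight n is"
    by blast
  obtain N' r where N': "N' \<in> M" "r \<in> states V" "name p = name r" "mat_to_list N = mat_to_list N'"
    "reach V (r, u) (q, N' *\<^sub>v u + weight n is)"
    using walk_imp_reach[OF assms(1) N(2,3)] assms(3) by auto
  then have "r = p" "N' = N"
    using inj_onD[OF inj_name, of r p] inj_onD[OF inj_mat_to_list, of N' N d]
      assms(2) N(1) monoid_carrier by auto
  then show "reach V (p, u) (q, v)"
    using N'(5) N(4) by simp
qed

end

text \<open>Regrouping by edges: the formula sees only multiplicities, while \<open>weight\<close>
  sums along the walk.\<close>

lemma sum_count_list:
  "set is \<subseteq> {..<m :: nat} \<Longrightarrow> (\<Sum>i<m. f i * int (count_list is i)) = (\<Sum>i\<leftarrow>is. f i)"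
proof (induction "is")
  case (Cons k "is")
  have "f i * int (count_list (k # is) i) = (if i = k then f i else 0) + f i * int (count_list is i)"
    for i
    by (simp add: algebra_simps)
  moreover have "(\<Sum>i<m. if i = k then f i else 0) = f k"
    using Cons.prems by (subst sum.delta) auto
  ultimately show ?case
    using Cons by (simp only: sum.distrib) simp
qed simp

section \<open>Norms, logarithms and bit lengths\<close>

lemma abs_vec_le_norm: "i < dim_vec v \<Longrightarrow> \<bar>v $ i\<bar> \<le> vec_norm v"
  unfolding vec_norm_def by (rule Max_ge) auto

lemma abs_mat_le_norm:
  assumes "i < dim_row A" "j < dim_col A"
  shows "\<bar>A $$ (i, j)\<bar> \<le> mat_norm A"
proof -
  have "\<bar>A $$ (i, j)\<bar> \<le> vec_norm (col A j)"
    using abs_vec_le_norm[of i "col A j"] assms by simp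
  also have "\<dots> \<le> mat_norm A"
    unfolding mat_norm_def using assms by (intro Max_ge) auto
  finally show ?thesis .
qed

lemma mats_norm_nonneg: "finite S \<Longrightarrow> 0 \<le> mats_norm S"
  unfolding mats_norm_def by (rule Max_ge) auto

lemma mat_norm_le: "finite S \<Longrightarrow> A \<in> S \<Longrightarrow> mat_norm A \<le> mats_norm S"
  unfolding mats_norm_def by (rule Max_ge) auto

lemma le_power_ceiling_log:
  assumes "0 \<le> x"
  shows "x \<le> (2 :: int) ^ nat \<lceil>log 2 (real_of_int x)\<rceil>"
proof (cases "x = 0")
  case False
  then have "real_of_int x = 2 powr log 2 (real_of_int x)"
    using assms by simp
  also have "\<dots> \<le> 2 powr real (nat \<lceil>log 2 (real_of_int x)\<rceil>)"
    by (intro powr_mono) linarith+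
  also have "\<dots> = real_of_int (2 ^ nat \<lceil>log 2 (real_of_int x)\<rceil>)"
    by (simp add: powr_realpow)
  finally show ?thesis
    by (simp only: of_int_le_iff)
qed simp

text \<open>Integrality matters: a nonnegative integer is at least 1, or it is 0 and has logarithm 0
  by convention.\<close>

lemma log_int_nonneg: "0 \<le> x \<Longrightarrow> 0 \<le> log 2 (real_of_int x)"
  by (cases "x = 0") (auto simp: log_def)

context zvass_instance
begin

text \<open>A coordinate of a weight is a sum of \<open>d\<close> products of an entry of the monoid
  and an entry of a vector. The two logarithms bound the factors, \<open>d\<close> bits pay for the
  number of summands, and the extra 1 makes the inequality strict.\<close>

definition digits :: nat where
  "digits = nat \<lceil>log 2 (real_of_int (mats_norm M))\<rceil> + 1 + d
     + nat \<lceil>log 2 (real_of_int (trans_norm V + 1))\<rceil>"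

lemma finite_trans: "finite (trans_mats V)" "finite (trans_vecs V)"
proof -
  have "finite (transitions V)"
    using affine by (simp add: affine_zvass_def)
  moreover have "trans_mats V = (\<lambda>(p, A, b, q). A) ` transitions V"
    "trans_vecs V = (\<lambda>(p, A, b, q). b) ` transitions V"
    by (force simp: trans_mats_def trans_vecs_def)+
  ultimately show "finite (trans_mats V)" "finite (trans_vecs V)"
    by simp_all
qed

lemma trans_norm_nonneg: "0 \<le> trans_norm V"
  unfolding trans_norm_def using finite_trans by (intro Max_ge) auto

lemma vec_norm_le_trans_norm: "b \<in> trans_vecs V \<Longrightarrow> vec_norm b \<le> trans_norm V"
  unfolding trans_norm_def using finite_trans by (intro Max_ge) auto

lemma abs_entry_le:
  assumes "N \<in> M" "i < d" "j < d"
  shows "\<bar>N $$ (i, j)\<bar> \<le> mats_norm M"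
  using abs_mat_le_norm[of i N j] mat_norm_le[OF finite_monoid assms(1)] monoid_carrier[OF assms(1)]
    assms(2,3) by auto

lemma abs_weight_le:
  assumes "N \<in> M" "(p, A, b, r) \<in> transitions V" "i < d"
  shows "\<bar>(N *\<^sub>v b) $ i\<bar> \<le> int d * (mats_norm M * trans_norm V)"
proof -
  have b: "\<bar>b $ k\<bar> \<le> trans_norm V" if "k < d" for k
  proof -
    have "b \<in> trans_vecs V"
      using assms(2) unfolding trans_vecs_def by blast
    then show ?thesis
      using abs_vec_le_norm[of k b] vec_norm_le_trans_norm[of b] transition(3)[OF assms(2)] that
      by auto
  qed
  have "(N *\<^sub>v b) $ i = (\<Sum>k<d. N $$ (i, k) * b $ k)"
    using monoid_carrier[OF assms(1)] transition(3)[OF assms(2)] assms(3)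
    by (auto simp: scalar_prod_def atLeast0LessThan)
  also have "\<bar>\<dots>\<bar> \<le> (\<Sum>k<d. \<bar>N $$ (i, k)\<bar> * \<bar>b $ k\<bar>)"
    by (rule order_trans[OF sum_abs]) (simp add: abs_mult)
  also have "\<dots> \<le> (\<Sum>k<d. mats_norm M * trans_norm V)"
    using abs_entry_le[OF assms(1,3)] b mats_norm_nonneg[OF finite_monoid]
    by (intro sum_mono mult_mono) auto
  finally show ?thesis
    by simp
qed

lemma mats_norm_less: "mats_norm M < 2 ^ digits"
  and weight_less: "int d * (mats_norm M * trans_norm V) < 2 ^ digits"
proof -
  let ?a = "nat \<lceil>log 2 (real_of_int (mats_norm M))\<rceil>"
  let ?b = "nat \<lceil>log 2 (real_of_int (trans_norm V + 1))\<rceil>"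
  have digits: "digits = Suc (?a + d + ?b)"
    by (simp add: digits_def)
  have a: "mats_norm M \<le> 2 ^ ?a"
    using le_power_ceiling_log[OF mats_norm_nonneg[OF finite_monoid]] .
  have b: "trans_norm V + 1 \<le> 2 ^ ?b"
    using le_power_ceiling_log[of "trans_norm V + 1"] trans_norm_nonneg by simp
  have d: "int d \<le> 2 ^ d"
    using of_nat_less_two_power[of d, where 'a = int] by simp
  have "mats_norm M \<le> 2 ^ (?a + d + ?b)"
    by (rule order_trans[OF a power_increasing], linarith, simp)
  also have "\<dots> < 2 ^ digits"
    unfolding digits by simp
  finally show "mats_norm M < 2 ^ digits" .
  have "int d * (mats_norm M * trans_norm V) \<le> 2 ^ d * (2 ^ ?a * 2 ^ ?b)"
    using a b d mats_norm_nonneg[OF finite_monoid] trans_norm_nonneg by (intro mult_mono) auto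
  also have "\<dots> < 2 ^ digits"
    unfolding digits by (simp add: power_add)
  finally show "int d * (mats_norm M * trans_norm V) < 2 ^ digits" .
qed

lemma nat_abs_less_power: "\<bar>c\<bar> \<le> m \<Longrightarrow> m < 2 ^ digits \<Longrightarrow> digits \<le> n \<Longrightarrow> nat \<bar>c\<bar> < 2 ^ n"
proof -
  assume *: "\<bar>c\<bar> \<le> m" "m < 2 ^ digits" "digits \<le> n"
  have "(2 :: int) ^ digits \<le> 2 ^ n"
    using *(3) by (intro power_increasing) auto
  with * have "\<bar>c\<bar> < 2 ^ n"
    by linarith
  then have "nat \<bar>c\<bar> < nat (2 ^ n)"
    by (subst nat_mono_iff) simp_all
  then show "nat \<bar>c\<bar> < 2 ^ n"
    by (simp add: nat_power_eq)
qed

text \<open>The sum serves both roles of the bound: it allows at least \<open>card M\<close> rounds,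
  after which the set of matrices no longer changes, and it is an exponent of at least
  \<open>digits\<close>.\<close>

lemma ready_at_bound: "ready d row_ts (card M + digits)" (is "ready d row_ts ?n")
proof -
  have st: "stable ?n"
    by (rule stable_mono[OF stable_at_card]) simp
  have "nat \<bar>c\<bar> < 2 ^ ?n" if L: "L \<in> set (Ms ?n)" "r \<in> set L" "c \<in> set r" for L r c
  proof -
    obtain N where N: "N \<in> M" "L = mat_to_list N"
      using L(1) stable_imp_Ms[OF st] by auto
    then obtain i j where "i < d" "j < d" "c = N $$ (i, j)"
      using L(2,3) by (auto simp: mat_to_list_carrier[OF monoid_carrier])
    then show ?thesis
      using abs_entry_le[OF N(1)] mats_norm_less by (intro nat_abs_less_power[of c "mats_norm M"]) auto
  qed
  moreover have "nat \<bar>c\<bar> < 2 ^ ?n" if x: "x \<in> set (es ?n)" "c \<in> set (fst (snd x))" for x c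
  proof -
    obtain N p A b r where N: "N \<in> M" and t: "(p, A, b, r) \<in> transitions V"
      and "c \<in> set (list_of_vec (N *\<^sub>v b))"
      using x unfolding set_es[OF st] by auto
    then obtain i where "i < d" "c = (N *\<^sub>v b) $ i"
      using list_of_vec_carrier[OF mult_mat_vec_carrier[OF monoid_carrier[OF N] transition(3)[OF t]]]
      by auto
    then show ?thesis
      using abs_weight_le[OF N t] weight_less by (intro nat_abs_less_power[OF _ weight_less]) auto
  qed
  ultimately show ?thesis
    using st unfolding ready_def stable_def by blast
qed

lemma ready_imp_stable: "ready d row_ts n \<Longrightarrow> stable n"
  by (auto simp: ready_def stable_def)

lemma ready_imp_bounded:
  assumes "ready d row_ts n" "L \<in> set (Ms n)"
  shows "coeffs_bounded d (es n) n source L"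
proof -
  have small: "\<bar>c\<bar> < 2 ^ n" if "nat \<bar>c\<bar> < 2 ^ n" for c :: int
  proof -
    have "int (nat \<bar>c\<bar>) < int (2 ^ n)"
      using that by (simp only: of_nat_less_iff)
    then show ?thesis by simp
  qed
  have fetch: "\<bar>fetch 0 xs i\<bar> < 2 ^ n" if "\<And>c. c \<in> set xs \<Longrightarrow> nat \<bar>c\<bar> < 2 ^ n" for xs i
    using small[OF that, of "xs ! i"] by (simp add: fetch_def)
  have "nat \<bar>c\<bar> < 2 ^ n" if "c \<in> set (fetch [] L r)" for c r
  proof -
    have "r < length L" "c \<in> set (L ! r)"
      using that by (auto simp: fetch_def split: if_splits)
    then show ?thesis
      using assms nth_mem[of r L] unfolding ready_def by blast
  qed
  then have "\<bar>fetch 0 (fetch [] L r) j\<bar> < 2 ^ n" for r j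
    by (rule fetch)
  moreover have "nat \<bar>c\<bar> < 2 ^ n" if "c \<in> set (edge_weight source (es n) i)" for c i
  proof -
    have "i < length (es n)" "c \<in> set (fst (snd (es n ! i)))"
      using that by (auto simp: edge_weight_def fetch_def split: if_splits)
    then show ?thesis
      using assms(1) nth_mem[of i "es n"] unfolding ready_def by blast
  qed
  then have "\<bar>fetch 0 (edge_weight source (es n) i) r\<bar> < 2 ^ n" for i r
    by (rule fetch)
  ultimately show ?thesis
    by (simp add: coeffs_bounded_def)
qed

lemma affine_value_assignment:
  assumes "N \<in> M" "u \<in> carrier_vec d" "set is \<subseteq> {..<length (es n)}" "r < d"
  shows "affine_value d (es n) source (mat_to_list N) (assignment d u v) (\<lambda>i. int (count_list is i)) r
    = (N *\<^sub>v u + weight n is) $ r"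
  unfolding affine_value_def sum_count_list[OF assms(3)]
  using monoid_carrier[OF assms(1)] assms(2,4)
  by (auto simp: mat_to_list_carrier assignment_def scalar_prod_def weight_def atLeast0LessThan
      intro!: sum.cong)

theorem holds_reach_formula:
  assumes "ready d row_ts n" "p \<in> states V" "u \<in> carrier_vec d" "v \<in> carrier_vec d"
  shows "holds (assignment d u v) (reach_formula d row_ts (name p) (name q) n)
    \<longleftrightarrow> reach V (p, u) (q, v)"
proof -
  have val: "(\<forall>r<d. assignment d u v (d + r) =
      affine_value d (es n) source (mat_to_list N) (assignment d u v) (\<lambda>i. int (count_list is i)) r)
    \<longleftrightarrow> v = N *\<^sub>v u + weight n is"
    if "N \<in> M" "set is \<subseteq> {..<length (es n)}" for N "is"
  proof -
    have eq: "(\<forall>r<d. v $ r = w $ r) \<longleftrightarrow> v = w" if "w \<in> carrier_vec d" for w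
      using assms(4) that by (auto intro!: eq_vecI)
    have "assignment d u v (d + r) = v $ r" if "r < d" for r
      using that by (simp add: assignment_def)
    then have "(\<forall>r<d. assignment d u v (d + r) =
        affine_value d (es n) source (mat_to_list N) (assignment d u v) (\<lambda>i. int (count_list is i)) r)
      \<longleftrightarrow> (\<forall>r<d. v $ r = (N *\<^sub>v u + weight n is) $ r)"
      using affine_value_assignment[OF that(1) assms(3) that(2)] by metis
    also have "\<dots> \<longleftrightarrow> v = N *\<^sub>v u + weight n is"
      using weight_carrier monoid_carrier[OF that(1)] assms(3) by (intro eq) auto
    finally show ?thesis .
  qed
  have "holds (assignment d u v) (reach_formula d row_ts (name p) (name q) n) \<longleftrightarrow>
    (\<exists>L\<in>set (Ms n). \<exists>is. walks n is (name p, L) \<and> set is \<subseteq> {..<length (es n)} \<and>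
      (\<forall>r<d. assignment d u v (d + r) =
        affine_value d (es n) source L (assignment d u v) (\<lambda>i. int (count_list is i)) r))"
    unfolding reach_formula_def
    by (subst holds_walk_formula) (auto intro: ready_imp_bounded[OF assms(1)])
  also have "\<dots> \<longleftrightarrow> (\<exists>N\<in>M. \<exists>is. walks n is (name p, mat_to_list N) \<and>
      set is \<subseteq> {..<length (es n)} \<and> v = N *\<^sub>v u + weight n is)"
    unfolding stable_imp_Ms[OF ready_imp_stable[OF assms(1)]] using val by blast
  also have "\<dots> \<longleftrightarrow> reach V (p, u) (q, v)"
    using reach_iff_walk[OF ready_imp_stable[OF assms(1)] assms(2,3)] by blast
  finally show ?thesis .
qed

subsection \<open>Size\<close>

text \<open>In dimension 0 the transitions do not contribute to the size of the instance.\<close>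

lemma card_transitions_le: "card (transitions V) \<le> (avass_size V)\<^sup>2"
proof (cases "d = 0")
  case True
  \<comment> \<open>There is one matrix and one vector of dimension 0, so the two states determine a
    transition; this is where the square comes from.\<close>
  have "inj_on (\<lambda>(p, A, b, q). (p, q)) (transitions V)"
  proof (rule inj_onI)
    fix t t' assume t: "t \<in> transitions V" "t' \<in> transitions V"
      "(case t of (p, A, b, q) \<Rightarrow> (p, q)) = (case t' of (p, A, b, q) \<Rightarrow> (p, q))"
    then obtain p A b r A' b' where eq: "t = (p, A, b, r)" "t' = (p, A', b', r)"
      by (cases t, cases t') auto
    then have "A \<in> carrier_mat 0 0" "A' \<in> carrier_mat 0 0" "b \<in> carrier_vec 0" "b' \<in> carrier_vec 0"
      using t(1,2) transition(2,3) True by auto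
    then show "t = t'"
      unfolding eq by auto
  qed
  then have "card (transitions V) \<le> card (states V \<times> states V)"
    using transition(1,4) affine by (intro card_inj_on_le) (auto simp: affine_zvass_def)
  also have "\<dots> \<le> (avass_size V)\<^sup>2"
    by (simp add: card_cartesian_product power2_eq_square avass_size_def mult_mono)
  finally show ?thesis .
next
  case False
  let ?m = "max 1 (nat \<lceil>log 2 (real_of_int (trans_norm V) + 1)\<rceil>)"
  have "1 * card (transitions V) * 1 \<le> (d\<^sup>2 + d) * card (transitions V) * ?m"
    using False by (intro mult_mono) auto
  also have "\<dots> \<le> avass_size V"
    by (simp add: avass_size_def)
  also have "\<dots> \<le> (avass_size V)\<^sup>2"
    by (simp add: power2_eq_square)
  finally show ?thesis by simp
qed

text \<open>If the transition term of the size is positive, it contains this logarithm as a factor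
  of a product of positive numbers; if it vanishes, so do all norms of transitions.\<close>

lemma trans_digits_le:
  "nat \<lceil>log 2 (real_of_int (trans_norm V + 1))\<rceil> \<le> avass_size V"
proof (cases "d = 0 \<or> transitions V = {}")
  case True
  have "mat_norm A = 0" if "A \<in> trans_mats V" for A
  proof -
    have "A \<in> carrier_mat 0 0"
      using that True transition(2) by (auto simp: trans_mats_def)
    then show ?thesis
      by (simp add: mat_norm_def)
  qed
  moreover have "vec_norm b = 0" if "b \<in> trans_vecs V" for b
  proof -
    have "b \<in> carrier_vec 0"
      using that True transition(3) by (auto simp: trans_vecs_def)
    then show ?thesis
      by (simp add: vec_norm_def)
  qed
  ultimately have "insert 0 (mat_norm ` trans_mats V \<union> vec_norm ` trans_vecs V) = {0}"
    by auto
  then have "trans_norm V = 0"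
    unfolding trans_norm_def by (simp only: Max_singleton)
  then show ?thesis by simp
next
  case False
  let ?m = "max 1 (nat \<lceil>log 2 (real_of_int (trans_norm V) + 1)\<rceil>)"
  have "finite (transitions V)"
    using affine by (simp add: affine_zvass_def)
  then have "1 * 1 * ?m \<le> (d\<^sup>2 + d) * card (transitions V) * ?m"
    using False by (intro mult_mono) (auto simp: Suc_le_eq card_gt_0_iff)
  also have "\<dots> \<le> avass_size V"
    by (simp add: avass_size_def)
  finally show ?thesis by simp
qed

text \<open>With \<open>S\<close> the quantity raised to the power, there are at most
  \<open>S ^ 3\<close> edges, and the bit bound \<open>n\<close> is at most
  \<open>S + 2 + d\<close>, hence at most \<open>4 * S\<close>. So \<open>A\<close> of order
  \<open>S ^ 3\<close> dominates all parameters; rounding it up turns the factor 4 into 5, and 500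
  times the sixth power of 5 is 7812500.\<close>

theorem fsize_reach_formula:
  assumes "n \<le> card M + digits"
  shows "real (fsize (reach_formula d row_ts (name p) (name q) n)) \<le> 7812500 *
    (real (avass_size V) + real (card M) + log 2 (real_of_int (mats_norm M))) ^ 18"
proof -
  define S where "S = real (avass_size V) + real (card M) + log 2 (real_of_int (mats_norm M))"
  define A where "A = nat \<lceil>4 * S ^ 3\<rceil>"
  have log: "0 \<le> log 2 (real_of_int (mats_norm M))"
    by (rule log_int_nonneg[OF mats_norm_nonneg[OF finite_monoid]])
  have "0 < card M"
    using finite_monoid avass_monoid.one by (auto simp: card_gt_0_iff)
  then have S1: "1 \<le> S"
    using log by (simp add: S_def)
  have S3: "S \<le> S ^ 3" "1 \<le> S ^ 3"
    using S1 power_increasing[of 1 3 S] one_le_power[OF S1] by auto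
  have A: "4 * S ^ 3 \<le> real A" "real A \<le> 5 * S ^ 3"
    using S3 unfolding A_def by linarith+
  have dS: "real d \<le> S" "real (avass_size V) \<le> S" "real (card M) \<le> S"
    using log by (auto simp: S_def avass_size_def)
  have "real (card M * card (transitions V)) \<le> S * S ^ 2"
    unfolding of_nat_mult
  proof (rule mult_mono)
    have "real (card (transitions V)) \<le> real (avass_size V) ^ 2"
      using card_transitions_le by (simp only: of_nat_power[symmetric] of_nat_le_iff)
    also have "\<dots> \<le> S ^ 2"
      using dS(2) by (intro power_mono) auto
    finally show "real (card (transitions V)) \<le> S ^ 2" .
  qed (use dS S1 in auto)
  moreover have "real (length (es n)) \<le> real (card M * card (transitions V))"
    using length_es[of n] by (simp only: of_nat_le_iff)
  ultimately have E: "real (length (es n)) \<le> S ^ 3"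
    by (simp add: power3_eq_cube power2_eq_square)
  have "real digits \<le> log 2 (real_of_int (mats_norm M)) + 2 + real d + real (avass_size V)"
  proof -
    have "real (nat \<lceil>log 2 (real_of_int (mats_norm M))\<rceil>) \<le> log 2 (real_of_int (mats_norm M)) + 1"
      using log by linarith
    then show ?thesis
      using trans_digits_le unfolding digits_def by linarith
  qed
  moreover have "real n \<le> real (card M) + real digits"
    using assms by linarith
  ultimately have "real n \<le> S + 2 + real d"
    by (simp add: S_def)
  then have K: "real n \<le> 4 * S"
    using dS(1) S1 by linarith
  have le_A: "m \<le> A" if "real m \<le> 4 * S ^ 3" for m
    using that A(1) by linarith
  have "real 1 \<le> 4 * S ^ 3" "real d \<le> 4 * S ^ 3" "real (length (es n)) \<le> 4 * S ^ 3"
    "real n \<le> 4 * S ^ 3" "real (card M) \<le> 4 * S ^ 3"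
    using S3 dS E K by linarith+
  note bounds = this[THEN le_A]
  have "fsize (reach_formula d row_ts (name p) (name q) n) \<le> 500 * A ^ 6"
    unfolding reach_formula_def using bounds length_Ms[of n] by (intro fsize_walk_formula) simp_all
  then have "real (fsize (reach_formula d row_ts (name p) (name q) n)) \<le> real (500 * A ^ 6)"
    by (simp only: of_nat_le_iff)
  also have "\<dots> = 500 * real A ^ 6"
    by simp
  also have "\<dots> \<le> 500 * (5 * S ^ 3) ^ 6"
    using A(2) by (intro mult_left_mono power_mono) auto
  also have "\<dots> = 7812500 * S ^ 18"
    by (simp add: power_mult_distrib flip: power_mult)
  finally show ?thesis
    unfolding S_def .
qed

end

theorem theorem4p1:
  "\<exists>(F :: nat \<Rightarrow> nat option) (c :: real) (k :: nat).
     partial_recursive F \<and>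
     (\<forall>(V :: 'q avass) p q w.
        affine_zvass V \<longrightarrow> finite_monoid_property V \<longrightarrow> p \<in> states V \<longrightarrow> q \<in> states V \<longrightarrow>
        is_instance_code w V p q \<longrightarrow>
        (\<exists>\<phi>. F w = Some (fcode \<phi>) \<and>
             existential \<phi> \<and>
             free_vars \<phi> \<subseteq> {..<2 * dimension V} \<and>
             real (fsize \<phi>) \<le>
               c * (real (avass_size V) + real (card (avass_monoid V))
                    + log 2 (real_of_int (mats_norm (avass_monoid V)))) ^ k \<and>
             (\<forall>u \<in> carrier_vec (dimension V). \<forall>v \<in> carrier_vec (dimension V).
                holds (assignment (dimension V) u v) \<phi> \<longleftrightarrow> reach V (p, u) (q, v))))"
proof -
  obtain F where F: "partial_recursive F"
    "\<And>w d ts p q n. parse w = (d, ts, p, q) \<Longrightarrow> ready d ts n \<Longrightarrow>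
       F w = Some (fcode (reach_formula d ts p q (LEAST n. ready d ts n)))"
    using partial_recursive_formula by blast
  show ?thesis
  proof (rule exI[of _ F], rule exI[of _ 7812500], rule exI[of _ 18], intro conjI allI impI F(1))
    fix V :: "'q avass" and p q w
    assume V: "affine_zvass V" "finite_monoid_property V" and pq: "p \<in> states V" "q \<in> states V"
      and "is_instance_code w V p q"
    then obtain name qs ts where inst: "inj_on name (states V)" "distinct ts" "set ts = transitions V"
      and w: "w = instance_code name (dimension V) qs ts p q"
      unfolding is_instance_code_def by blast
    interpret zvass_instance V name ts q
      using V pq inst by unfold_locales (auto simp: finite_monoid_property_def)
    have parse: "parse w = (d, row_ts, name p, name q)"
      unfolding w parse_instance_code row_ts_def ..
    define n where "n = (LEAST n. ready d row_ts n)"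
    \<comment> \<open>One admissible bound shows that the search ends, and minimality transfers its
      value to the size estimate.\<close>
    have n: "ready d row_ts n" "n \<le> card M + digits"
      using LeastI[of "ready d row_ts", OF ready_at_bound] Least_le[of "ready d row_ts", OF ready_at_bound]
      unfolding n_def by auto
    let ?f = "reach_formula d row_ts (name p) (name q) n"
    have "F w = Some (fcode ?f)"
      using F(2)[OF parse n(1)] unfolding n_def .
    moreover have "existential ?f" "free_vars ?f \<subseteq> {..<2 * d}"
      unfolding reach_formula_def by (rule existential_walk_formula free_vars_walk_formula)+
    ultimately show "\<exists>\<phi>. F w = Some (fcode \<phi>) \<and> existential \<phi> \<and> free_vars \<phi> \<subseteq> {..<2 * d} \<and>
        real (fsize \<phi>) \<le> 7812500 * (real (avass_size V) + real (card M)
          + log 2 (real_of_int (mats_norm M))) ^ 18 \<and>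
        (\<forall>u\<in>carrier_vec d. \<forall>v\<in>carrier_vec d.
          holds (assignment d u v) \<phi> \<longleftrightarrow> reach V (p, u) (q, v))"
      using fsize_reach_formula[OF n(2)] holds_reach_formula[OF n(1) pq(1)] by blast
  qed
qed

end
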